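(* Let $G$ be a graph on $n$ vertices and let $\mathcal{T}_1=(B_1,l_1)$ and $\mathcal{T}_2=(B_2,l_2)$ be two labelled spanning trees of $G$ such that for each label $i$, the edge $l_1^{-1}(i)$ and the edge $l_2^{-1}(i)$ lie in the same 2-connected component (block) of $G$. Then $\mathcal{T}_1$ can be reconfigured to $\mathcal{T}_2$ using $O(n\log n)$ basis exchange steps.
   Context: A labelled spanning tree of an $n$-vertex graph $G$ is a pair $(B,l)$ where $B$ is the edge set of a spanning tree and $l:B\to\{1,\ldots,n-1\}$ is a bijection. A basis exchange step on $(B,l)$ removes an edge $e\in B$ and adds an edge $e'\notin B$ such that $(B\setminus\{e\})\cup\{e'\}$ is a spanning tree; $e'$ receives the label $l(e)$ and all other labels are unchanged. Two edges lie in the same block of $G$ iff they are equal or some cycle of $G$ contains both. *)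

theory Defs
  imports Complex_Main "HOL-Library.FuncSet" "HOL-Library.Landau_Symbols"
begin

definition simple_graph :: "'a set \<Rightarrow> 'a set set \<Rightarrow> bool" where
  "simple_graph V E \<longleftrightarrow> finite V \<and> (\<forall>e\<in>E. e \<subseteq> V \<and> card e = 2)"

definition graph_connected :: "'a set \<Rightarrow> 'a set set \<Rightarrow> bool" where
  "graph_connected V E \<longleftrightarrow> (\<forall>u\<in>V. \<forall>v\<in>V. (u, v) \<in> {(x, y). {x, y} \<in> E}\<^sup>*)"

text \<open>A cycle is given by the list of its distinct vertices in cyclic order.\<close>

definition cycle_edges :: "'a list \<Rightarrow> 'a set set" where
  "cycle_edges vs = {{vs ! i, vs ! (Suc i mod length vs)} | i. i < length vs}"

definition is_cycle :: "'a set set \<Rightarrow> 'a list \<Rightarrow> bool" where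
  "is_cycle E vs \<longleftrightarrow> 3 \<le> length vs \<and> distinct vs \<and> cycle_edges vs \<subseteq> E"

definition spanning_tree :: "'a set \<Rightarrow> 'a set set \<Rightarrow> 'a set set \<Rightarrow> bool" where
  "spanning_tree V E B \<longleftrightarrow> B \<subseteq> E \<and> graph_connected V B \<and> (\<nexists>vs. is_cycle B vs)"

definition same_block :: "'a set set \<Rightarrow> 'a set \<Rightarrow> 'a set \<Rightarrow> bool" where
  "same_block E e f \<longleftrightarrow>
     e = f \<or> (\<exists>vs. is_cycle E vs \<and> e \<in> cycle_edges vs \<and> f \<in> cycle_edges vs)"

text \<open>Labellings are extensional (\<^const>\<open>undefined\<close> outside the tree), so that equality of pairs
  is equality of labelled trees.\<close>

type_synonym 'a labelled_tree = "'a set set \<times> ('a set \<Rightarrow> nat)"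

definition labelled_spanning_tree :: "'a set \<Rightarrow> 'a set set \<Rightarrow> 'a labelled_tree \<Rightarrow> bool" where
  "labelled_spanning_tree V E = (\<lambda>(B, l).
     spanning_tree V E B \<and> l \<in> extensional B \<and> bij_betw l B {1..card V - 1})"

definition exchange_step ::
    "'a set \<Rightarrow> 'a set set \<Rightarrow> 'a labelled_tree \<Rightarrow> 'a labelled_tree \<Rightarrow> bool" where
  "exchange_step V E = (\<lambda>(B, l) (B', l').
     \<exists>e\<in>B. \<exists>e'\<in>E - B.
       B' = (B - {e}) \<union> {e'} \<and> spanning_tree V E B' \<and> l' = restrict (l(e' := l e)) B')"

end

theory Submission
  imports Defs "HOL-Library.Discrete_Functions" "HOL-Combinatorics.Transposition"
    "HOL-Real_Asymp.Real_Asymp"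
begin

text \<open>
  Two edges of a spanning tree \<open>B\<close> share a circuit if some edge \<open>x\<close> outside \<open>B\<close> closes a cycle
  through both of them; then three exchanges, using \<open>x\<close> as a buffer, swap their labels. By
  conjugation, the labels of two edges at distance \<open>k\<close> can be swapped in \<open>O(k)\<close> exchanges.
  It therefore suffices to find one spanning tree in which any two edges of the same block have
  distance \<open>O(log n)\<close>: both labelled trees are first moved to it in at most \<open>n\<close> exchanges
  each, and the labels are then sorted by at most \<open>n\<close> transpositions.

  Splitting at cut vertices reduces the construction of that tree to graphs without a cut vertex.
  There we start from one edge and add ears. Through a component \<open>K\<close> of the vertices not yet
  covered there is an ear that leaves only components with at most \<open>|K| / 2\<close> vertices: if an ear
  leaves a larger component \<open>C\<close>, reroute it through \<open>C\<close> between two consecutive attachments of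
  \<open>C\<close>, which strictly shrinks the large component. Dropping one edge of the ear makes all its other
  edges share a circuit with an edge of the old tree, so each halving costs one unit of distance.
\<close>


section \<open>Bounded reachability\<close>

definition within_steps :: "('a \<Rightarrow> 'a \<Rightarrow> bool) \<Rightarrow> nat \<Rightarrow> 'a \<Rightarrow> 'a \<Rightarrow> bool" where
  "within_steps R d x y \<longleftrightarrow> (\<exists>k\<le>d. (R ^^ k) x y)"

lemma within_steps_refl [simp]: "within_steps R d x x"
  unfolding within_steps_def by (intro exI[of _ 0]) simp

lemma within_steps_single: "R x y \<Longrightarrow> within_steps R 1 x y"
  unfolding within_steps_def by (intro exI[of _ 1]) (auto simp: relcompp.simps)

lemma within_steps_mono: "within_steps R d x y \<Longrightarrow> d \<le> d' \<Longrightarrow> within_steps R d' x y"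
  unfolding within_steps_def by (meson order_trans)

lemma within_steps_rel_mono: "within_steps R d x y \<Longrightarrow> R \<le> R' \<Longrightarrow> within_steps R' d x y"
  unfolding within_steps_def using relpowp_mono[of R R'] by (meson predicate2D)

lemma within_steps_trans:
  assumes "within_steps R d x y" "within_steps R d' y z"
  shows "within_steps R (d + d') x z"
proof -
  obtain i j where "i \<le> d" "(R ^^ i) x y" "j \<le> d'" "(R ^^ j) y z"
    using assms unfolding within_steps_def by blast
  then show ?thesis
    unfolding within_steps_def by (intro exI[of _ "i + j"]) (auto simp: relpowp_add)
qed

lemma within_steps_imp_rtranclp: "within_steps R d x y \<Longrightarrow> R\<^sup>*\<^sup>* x y"
  unfolding within_steps_def by (auto intro: relpowp_imp_rtranclp)

lemma within_steps_reverse: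
  assumes "within_steps R d x y" "I x" and reversible: "\<And>x y. I x \<Longrightarrow> R x y \<Longrightarrow> I y \<and> R y x"
  shows "within_steps R d y x"
proof -
  have "I y \<and> (R ^^ k) y x" if "(R ^^ k) x y" for k y
    using that
  proof (induction k arbitrary: y)
    case 0
    with \<open>I x\<close> show ?case by simp
  next
    case (Suc k)
    then obtain z where "(R ^^ k) x z" "R z y" by auto
    with Suc.IH have "I z" "(R ^^ k) z x" by auto
    with reversible \<open>R z y\<close> show ?case by (meson relpowp_Suc_I2)
  qed
  then show ?thesis using assms(1) unfolding within_steps_def by blast
qed


section \<open>Connected graphs\<close>

definition reach :: "'a set set \<Rightarrow> ('a \<times> 'a) set" where
  "reach A = {(x, y). {x, y} \<in> A}\<^sup>*"

lemma reach_refl [simp]: "(x, x) \<in> reach A"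
  unfolding reach_def by simp

lemma reach_mono: "(x, y) \<in> reach A \<Longrightarrow> A \<subseteq> A' \<Longrightarrow> (x, y) \<in> reach A'"
  unfolding reach_def using rtrancl_mono[of "{(x, y). {x, y} \<in> A}" "{(x, y). {x, y} \<in> A'}"] by auto

lemma reach_trans: "(x, y) \<in> reach A \<Longrightarrow> (y, z) \<in> reach A \<Longrightarrow> (x, z) \<in> reach A"
  unfolding reach_def by (rule rtrancl_trans)

lemma reach_sym: "(x, y) \<in> reach A \<Longrightarrow> (y, x) \<in> reach A"
  unfolding reach_def
proof (rule symD[OF sym_rtrancl])
  show "sym {(x, y). {x, y} \<in> A}" by (auto simp: sym_def insert_commute)
qed

lemma reach_edge: "{x, y} \<in> A \<Longrightarrow> (x, y) \<in> reach A"
  unfolding reach_def by auto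

lemma reach_induct [consumes 1, case_names refl step]:
  assumes "(x, y) \<in> reach A" "P x"
    and "\<And>y z. (x, y) \<in> reach A \<Longrightarrow> {y, z} \<in> A \<Longrightarrow> P y \<Longrightarrow> P z"
  shows "P y"
  using assms unfolding reach_def by (induction rule: rtrancl_induct) auto

lemma reach_empty: "(x, y) \<in> reach {} \<longleftrightarrow> x = y"
  unfolding reach_def by simp

lemma reach_closed:
  assumes "(x, y) \<in> reach A" "x \<in> K" "\<And>a b. a \<in> K \<Longrightarrow> {a, b} \<in> A \<Longrightarrow> b \<in> K"
  shows "y \<in> K"
  using assms by (induction rule: reach_induct) auto

lemma reach_replace:
  assumes "(x, y) \<in> reach A" "\<And>a b. {a, b} \<in> A \<Longrightarrow> (a, b) \<in> reach A'"
  shows "(x, y) \<in> reach A'"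
  using assms by (induction rule: reach_induct) (auto intro: reach_trans)

lemma graph_connected_iff_reach:
  "graph_connected V A \<longleftrightarrow> (\<forall>u\<in>V. \<forall>v\<in>V. (u, v) \<in> reach A)"
  unfolding graph_connected_def reach_def ..

lemma graph_connectedI:
  assumes "\<And>v. v \<in> V \<Longrightarrow> (r, v) \<in> reach A"
  shows "graph_connected V A"
  unfolding graph_connected_iff_reach using assms by (blast intro: reach_sym reach_trans)

lemma graph_connectedD: "graph_connected V A \<Longrightarrow> u \<in> V \<Longrightarrow> v \<in> V \<Longrightarrow> (u, v) \<in> reach A"
  unfolding graph_connected_iff_reach by blast

lemma graph_connected_mono:
  "graph_connected V A \<Longrightarrow> V' \<subseteq> V \<Longrightarrow> A \<subseteq> A' \<Longrightarrow> graph_connected V' A'"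
  unfolding graph_connected_iff_reach by (blast intro: reach_mono)

lemma graph_connected_replace:
  assumes "graph_connected V A" "\<And>a b. {a, b} \<in> A \<Longrightarrow> (a, b) \<in> reach A'"
  shows "graph_connected V A'"
  using assms unfolding graph_connected_iff_reach by (blast intro: reach_replace)

lemma graph_connected_Un:
  assumes "graph_connected V A" "graph_connected V' A'" "V \<inter> V' \<noteq> {}"
  shows "graph_connected (V \<union> V') (A \<union> A')"
proof -
  obtain s where s: "s \<in> V" "s \<in> V'" using assms(3) by blast
  have "(s, v) \<in> reach (A \<union> A')" if "v \<in> V \<union> V'" for v
    using that
  proof
    assume "v \<in> V"
    show ?thesis by (rule reach_mono[OF graph_connectedD[OF assms(1) s(1) \<open>v \<in> V\<close>]]) simp
  next
    assume "v \<in> V'"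
    show ?thesis by (rule reach_mono[OF graph_connectedD[OF assms(2) s(2) \<open>v \<in> V'\<close>]]) simp
  qed
  then show ?thesis by (rule graph_connectedI)
qed

lemma graph_connected_edge: "graph_connected {a, b} {{a, b}}"
  by (rule graph_connectedI[of _ a]) (auto intro: reach_edge)

lemma graph_connected_crossing_edge:
  assumes "graph_connected V E" "x \<in> V" "x \<in> U" "y \<in> V" "y \<notin> U"
  obtains a b where "{a, b} \<in> E" "a \<in> U" "b \<notin> U"
  using reach_closed[OF graph_connectedD[OF assms(1,2,4)] assms(3)] assms(5) by blast

definition induced_edges :: "'a set set \<Rightarrow> 'a set \<Rightarrow> 'a set set" where
  "induced_edges E S = {e \<in> E. e \<subseteq> S}"

lemma induced_edges_subset: "induced_edges E S \<subseteq> E"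
  unfolding induced_edges_def by blast

lemma induced_edges_insert:
  "induced_edges (insert e A) S =
    (if e \<subseteq> S then insert e (induced_edges A S) else induced_edges A S)"
  unfolding induced_edges_def by auto

lemma induced_edges_mono: "S \<subseteq> S' \<Longrightarrow> induced_edges E S \<subseteq> induced_edges E S'"
  unfolding induced_edges_def by blast

lemma simple_graph_finite_edges: "simple_graph V E \<Longrightarrow> finite E"
  unfolding simple_graph_def by (rule finite_subset[of _ "Pow V"]) auto

lemma simple_graph_mono: "simple_graph V E \<Longrightarrow> A \<subseteq> E \<Longrightarrow> simple_graph V A"
  unfolding simple_graph_def by blast

lemma simple_graph_induced: "simple_graph V E \<Longrightarrow> S \<subseteq> V \<Longrightarrow> simple_graph S (induced_edges E S)"
  unfolding simple_graph_def induced_edges_def using finite_subset by blast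

lemma induced_edges_vertices: "simple_graph V E \<Longrightarrow> induced_edges E V = E"
  unfolding simple_graph_def induced_edges_def by blast

lemma connected_grow_induct [consumes 4, case_names start grow]:
  assumes "simple_graph V E" "graph_connected V E" "U \<subseteq> V" "U \<noteq> {}"
    and start: "P U"
    and grow: "\<And>W a b. U \<subseteq> W \<Longrightarrow> W \<subseteq> V \<Longrightarrow> a \<in> W \<Longrightarrow> b \<in> V - W \<Longrightarrow> {a, b} \<in> E \<Longrightarrow>
      P W \<Longrightarrow> P (insert b W)"
  shows "P V"
proof -
  have finite: "finite V" using assms(1) unfolding simple_graph_def by simp
  have "P V" if "U \<subseteq> W" "W \<subseteq> V" "P W" for W
    using that
  proof (induction "card (V - W)" arbitrary: W rule: less_induct)
    case less
    show ?case
    proof (cases "W = V")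
      case False
      then obtain x y where "x \<in> W" "x \<in> V" "y \<in> V" "y \<notin> W"
        using less.prems \<open>U \<noteq> {}\<close> by blast
      then obtain a b where edge: "{a, b} \<in> E" "a \<in> W" "b \<notin> W"
        using graph_connected_crossing_edge[OF assms(2)] by metis
      then have b: "b \<in> V - W" using assms(1) unfolding simple_graph_def by auto
      then have "card (V - insert b W) < card (V - W)"
        using finite by (intro psubset_card_mono) auto
      moreover have "P (insert b W)" using grow less.prems edge b by blast
      ultimately show ?thesis using less.hyps[of "insert b W"] less.prems b by auto
    qed (use less in simp)
  qed
  then show ?thesis using start \<open>U \<subseteq> V\<close> by blast
qed

lemma connected_card_edges_ge:
  assumes "simple_graph V E" "graph_connected V E"
  shows "card V - 1 \<le> card E"
proof (cases "V = {}")
  case False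
  then obtain r where "{r} \<subseteq> V" "{r} \<noteq> {}" by blast
  have finite: "finite V" "finite E"
    using assms(1) simple_graph_finite_edges unfolding simple_graph_def by auto
  have "card V - 1 \<le> card (induced_edges E V)"
    using assms \<open>{r} \<subseteq> V\<close> \<open>{r} \<noteq> {}\<close>
  proof (induction rule: connected_grow_induct)
    case (grow W a b)
    have finite_induced: "finite (induced_edges E S)" for S
      using finite(2) induced_edges_subset by (rule finite_subset[rotated])
    have "insert {a, b} (induced_edges E W) \<subseteq> induced_edges E (insert b W)"
      using grow unfolding induced_edges_def by auto
    moreover have "{a, b} \<notin> induced_edges E W" using grow unfolding induced_edges_def by auto
    ultimately have "Suc (card (induced_edges E W)) \<le> card (induced_edges E (insert b W))"
      using card_mono[OF finite_induced] card_insert_disjoint[OF finite_induced] by metis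
    moreover have "finite W" using grow finite(1) finite_subset by blast
    then have "card (insert b W) = Suc (card W)" using grow by simp
    ultimately show ?case using grow by simp
  qed simp
  then show ?thesis using induced_edges_vertices[OF assms(1)] by simp
qed simp

lemma connected_extension:
  assumes "simple_graph V E" "graph_connected V E" "U \<subseteq> V" "U \<noteq> {}"
  shows "\<exists>Q\<subseteq>E. card Q \<le> card V - card U \<and>
    (\<forall>A. graph_connected U A \<longrightarrow> graph_connected V (A \<union> Q))"
  using assms
proof (induction rule: connected_grow_induct)
  case start
  show ?case by (intro exI[of _ "{}"]) simp
next
  case (grow W a b)
  then obtain Q where Q: "Q \<subseteq> E" "card Q \<le> card W - card U"
    and connects: "\<And>A. graph_connected U A \<Longrightarrow> graph_connected W (A \<union> Q)" by blast
  have "finite W" using grow assms(1) finite_subset unfolding simple_graph_def by blast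
  then have "card (insert b W) = Suc (card W)" "card U \<le> card W"
    using grow card_mono by auto
  then have "card (insert {a, b} Q) \<le> card (insert b W) - card U"
    using card_insert_le_m1[of "card (insert b W) - card U" Q "{a, b}"] Q(2) by simp
  moreover have "graph_connected (insert b W) (A \<union> insert {a, b} Q)" if "graph_connected U A" for A
  proof -
    have "W \<inter> {a, b} \<noteq> {}" "W \<union> {a, b} = insert b W" using grow by auto
    then show ?thesis
      using graph_connected_Un[OF connects[OF that] graph_connected_edge, of a b] by simp
  qed
  ultimately show ?case using Q(1) grow by (intro exI[of _ "insert {a, b} Q"]) auto
qed


section \<open>Paths and cycles\<close>

fun path_edges :: "'a list \<Rightarrow> 'a set set" where
  "path_edges (x # y # zs) = insert {x, y} (path_edges (y # zs))"
| "path_edges _ = {}"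

definition is_path :: "'a set set \<Rightarrow> 'a list \<Rightarrow> bool" where
  "is_path A P \<longleftrightarrow> P \<noteq> [] \<and> distinct P \<and> path_edges P \<subseteq> A"

lemma path_edges_Cons: "ys \<noteq> [] \<Longrightarrow> path_edges (x # ys) = insert {x, hd ys} (path_edges ys)"
  by (cases ys) auto

lemma path_edges_append:
  assumes "ys \<noteq> []"
  shows "xs \<noteq> [] \<Longrightarrow>
    path_edges (xs @ ys) = insert {last xs, hd ys} (path_edges xs \<union> path_edges ys)"
  using assms by (induction xs rule: path_edges.induct) (auto simp: path_edges_Cons)

lemma is_path_append:
  assumes "xs \<noteq> []" "ys \<noteq> []"
  shows "is_path A (xs @ ys) \<longleftrightarrow>
    is_path A xs \<and> is_path A ys \<and> {last xs, hd ys} \<in> A \<and> set xs \<inter> set ys = {}"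
  using assms unfolding is_path_def by (auto simp: path_edges_append)

lemma path_edges_split:
  assumes "e \<in> path_edges P"
  obtains xs ys where "P = xs @ ys" "xs \<noteq> []" "ys \<noteq> []" "e = {last xs, hd ys}"
proof -
  have "\<exists>xs ys. P = xs @ ys \<and> xs \<noteq> [] \<and> ys \<noteq> [] \<and> e = {last xs, hd ys}"
    using assms
  proof (induction P rule: path_edges.induct)
    case (1 x y zs)
    show ?case
    proof (cases "e = {x, y}")
      case True
      then show ?thesis by (intro exI[of _ "[x]"] exI[of _ "y # zs"]) simp
    next
      case False
      then obtain xs ys where "y # zs = xs @ ys" "xs \<noteq> []" "ys \<noteq> []" "e = {last xs, hd ys}"
        using 1 by auto
      then show ?thesis by (intro exI[of _ "x # xs"] exI[of _ ys]) simp
    qed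
  qed simp_all
  then show ?thesis using that by blast
qed

lemma path_edges_subset: "e \<in> path_edges P \<Longrightarrow> e \<subseteq> set P"
  by (induction P rule: path_edges.induct) auto

lemma finite_path_edges [simp]: "finite (path_edges P)"
  by (induction P rule: path_edges.induct) auto

lemma card_path_edges_le: "card (path_edges P) \<le> length P - 1"
  by (induction P rule: path_edges.induct) (auto simp: card_insert_if)

lemma reach_path_edges: "z \<in> set P \<Longrightarrow> (hd P, z) \<in> reach (path_edges P)"
proof (induction P rule: path_edges.induct)
  case (1 x y zs)
  show ?case
  proof (cases "z = x")
    case False
    then have "(y, z) \<in> reach (path_edges (y # zs))" using 1 by simp
    then have "(y, z) \<in> reach (path_edges (x # y # zs))" by (rule reach_mono) auto
    moreover have "(x, y) \<in> reach (path_edges (x # y # zs))" by (rule reach_edge) simp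
    ultimately show ?thesis using reach_trans by fastforce
  qed simp
qed auto

lemma graph_connected_path: "graph_connected (set P) (path_edges P)"
  by (rule graph_connectedI) (rule reach_path_edges)

lemma reach_imp_path:
  assumes "(x, y) \<in> reach A"
  obtains P where "is_path A P" "hd P = x" "last P = y"
proof -
  have "\<exists>P. is_path A P \<and> hd P = x \<and> last P = y"
    using assms
  proof (induction rule: reach_induct)
    case refl
    show ?case by (intro exI[of _ "[x]"]) (simp add: is_path_def)
  next
    case (step y z)
    then obtain P where P: "is_path A P" "hd P = x" "last P = y" by blast
    then have "P \<noteq> []" unfolding is_path_def by simp
    show ?case
    proof (cases "z \<in> set P")
      case True
      then obtain xs ys where "P = (xs @ [z]) @ ys" by (auto dest: split_list)
      then have "is_path A (xs @ [z])" "hd (xs @ [z]) = x"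
        using P is_path_append[of "xs @ [z]" ys A] by (cases "ys = []"; cases xs; auto)+
      then show ?thesis by (intro exI[of _ "xs @ [z]"]) simp
    next
      case False
      then have "is_path A (P @ [z])"
        using P \<open>P \<noteq> []\<close> step(2) by (simp add: is_path_append) (simp add: is_path_def)
      then show ?thesis using P \<open>P \<noteq> []\<close> by (intro exI[of _ "P @ [z]"]) simp
    qed
  qed
  then show ?thesis using that by blast
qed

lemma reach_path_edges_remove:
  assumes "distinct P" "e \<in> path_edges P" "z \<in> set P"
  shows "(hd P, z) \<in> reach (path_edges P - {e}) \<or> (last P, z) \<in> reach (path_edges P - {e})"
proof -
  obtain xs ys where P: "P = xs @ ys" "xs \<noteq> []" "ys \<noteq> []" and e: "e = {last xs, hd ys}"
    using path_edges_split[OF assms(2)] by blast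
  have "last xs \<notin> set ys" "hd ys \<notin> set xs" using assms(1) P by (auto simp: disjoint_iff)
  then have "e \<notin> path_edges xs" "e \<notin> path_edges ys" using path_edges_subset[of e] e by auto
  then have subset: "path_edges xs \<subseteq> path_edges P - {e}" "path_edges ys \<subseteq> path_edges P - {e}"
    using P by (auto simp: path_edges_append)
  from assms(3) consider "z \<in> set xs" | "z \<in> set ys" using P by auto
  then show ?thesis
  proof cases
    case 1
    then have "(hd xs, z) \<in> reach (path_edges xs)" by (rule reach_path_edges)
    then show ?thesis using reach_mono[OF _ subset(1)] P by auto
  next
    case 2
    then have "(last ys, z) \<in> reach (path_edges ys)"
      using P(3) by (intro graph_connectedD[OF graph_connected_path]) auto
    then show ?thesis using reach_mono[OF _ subset(2)] P by auto
  qed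
qed

lemma graph_connected_add_path:
  assumes "graph_connected S A" "distinct P" "hd P \<in> S" "last P \<in> S" "x \<in> path_edges P"
  shows "graph_connected (S \<union> set P) (A \<union> (path_edges P - {x}))"
proof (rule graph_connectedI)
  let ?A = "A \<union> (path_edges P - {x})"
  have old: "(hd P, z) \<in> reach ?A" if "z \<in> S" for z
    using graph_connectedD[OF assms(1,3) that] by (rule reach_mono) simp
  fix v assume "v \<in> S \<union> set P"
  then show "(hd P, v) \<in> reach ?A"
  proof
    assume "v \<in> set P"
    from reach_path_edges_remove[OF assms(2,5) this]
    have "(hd P, v) \<in> reach ?A \<or> (last P, v) \<in> reach ?A" by (blast intro: reach_mono)
    then show ?thesis using old[OF assms(4)] reach_trans by metis
  qed (rule old)
qed

lemma graph_connected_bypass: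
  assumes "graph_connected V B" "is_path B P" "e \<in> path_edges P"
    and "B - {e} \<subseteq> A" "(hd P, last P) \<in> reach A"
  shows "graph_connected V A"
proof (rule graph_connected_replace[OF assms(1)])
  have "distinct P" "path_edges P - {e} \<subseteq> A" using assms(2,4) unfolding is_path_def by auto
  then have from_hd: "(hd P, z) \<in> reach A" if "z \<in> set P" for z
    using reach_path_edges_remove[OF _ assms(3) that] assms(5)
    by (blast intro: reach_mono reach_trans)
  fix a b assume "{a, b} \<in> B"
  show "(a, b) \<in> reach A"
  proof (cases "{a, b} = e")
    case True
    then have "a \<in> set P" "b \<in> set P" using path_edges_subset[OF assms(3)] by auto
    then show ?thesis using from_hd reach_sym reach_trans by metis
  qed (use \<open>{a, b} \<in> B\<close> assms(4) in \<open>auto intro: reach_edge\<close>)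
qed

lemma connected_replaceable_edge:
  assumes "graph_connected V B" "B\<^sub>0 \<subseteq> B" "(u, w) \<in> reach B\<^sub>0" "(u, w) \<notin> reach C"
  obtains e where "e \<in> B\<^sub>0 - C"
    "\<And>A. B - {e} \<subseteq> A \<Longrightarrow> (u, w) \<in> reach A \<Longrightarrow> graph_connected V A"
proof -
  obtain P where P: "is_path B\<^sub>0 P" "hd P = u" "last P = w"
    using reach_imp_path[OF assms(3)] by blast
  then have "(u, w) \<in> reach (path_edges P)"
    using reach_path_edges[of w P] unfolding is_path_def by auto
  then have "\<not> path_edges P \<subseteq> C" using assms(4) reach_mono by metis
  then obtain e where e: "e \<in> path_edges P" "e \<notin> C" by blast
  have "is_path B P" "e \<in> B\<^sub>0" using P(1) e(1) assms(2) unfolding is_path_def by auto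
  show ?thesis
  proof (rule that)
    show "e \<in> B\<^sub>0 - C" using \<open>e \<in> B\<^sub>0\<close> e(2) by simp
    show "graph_connected V A" if "B - {e} \<subseteq> A" "(u, w) \<in> reach A" for A
      by (rule graph_connected_bypass[OF assms(1) \<open>is_path B P\<close> e(1) that(1)])
        (use that(2) P(2,3) in simp)
  qed
qed

lemma path_edges_conv_nth: "path_edges P = (\<lambda>i. {P ! i, P ! Suc i}) ` {..<length P - 1}"
proof (induction P rule: path_edges.induct)
  case (1 x y zs)
  then show ?case by (simp add: lessThan_Suc_eq_insert_0 image_image)
qed auto

lemma cycle_edges_conv_path_edges:
  assumes "vs \<noteq> []"
  shows "cycle_edges vs = insert {last vs, hd vs} (path_edges vs)"
proof -
  obtain n where n: "length vs = Suc n" using assms by (cases vs) auto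
  then have "vs ! n = last vs" "vs ! 0 = hd vs"
    using assms by (auto simp: last_conv_nth hd_conv_nth)
  moreover have "cycle_edges vs = (\<lambda>i. {vs ! i, vs ! (Suc i mod Suc n)}) ` {..<Suc n}"
    unfolding cycle_edges_def n by auto
  ultimately show ?thesis
    unfolding path_edges_conv_nth n by (auto simp: lessThan_Suc)
qed

lemma cycle_edges_append_commute: "cycle_edges (xs @ ys) = cycle_edges (ys @ xs)"
proof (cases "xs = [] \<or> ys = []")
  case False
  then show ?thesis by (auto simp: cycle_edges_conv_path_edges path_edges_append insert_commute)
qed auto

lemma ends_notin_path_edges:
  assumes "distinct P" "3 \<le> length P"
  shows "{hd P, last P} \<notin> path_edges P"
proof
  assume "{hd P, last P} \<in> path_edges P"
  then obtain xs ys where P: "P = xs @ ys" "xs \<noteq> []" "ys \<noteq> []"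
    and ends: "{hd P, last P} = {last xs, hd ys}" by (rule path_edges_split)
  then have "hd xs \<noteq> hd ys" "last ys \<noteq> last xs" using assms(1)
    by (metis disjoint_iff distinct_append hd_in_set last_in_set)+
  then have "hd xs = last xs" "hd ys = last ys" using ends P by (auto simp: doubleton_eq_iff)
  then have "length xs = 1" "length ys = 1"
    using assms(1) P by (cases xs; cases ys; auto split: if_splits)+
  then show False using assms(2) P(1) by simp
qed

lemma cycle_remove_edge_path:
  assumes "is_cycle E vs" "e \<in> cycle_edges vs"
  obtains P where "set P = set vs" "length P = length vs" "cycle_edges vs - {e} = path_edges P"
proof -
  have vs: "3 \<le> length vs" "distinct vs" using assms(1) unfolding is_cycle_def by auto
  have "\<exists>xs ys. vs = xs @ ys \<and> ys @ xs \<noteq> [] \<and> e = {hd (ys @ xs), last (ys @ xs)}"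
  proof (cases "e \<in> path_edges vs")
    case True
    then obtain xs ys where "vs = xs @ ys" "xs \<noteq> []" "ys \<noteq> []" "e = {last xs, hd ys}"
      by (rule path_edges_split)
    then show ?thesis by (intro exI[of _ xs] exI[of _ ys]) auto
  next
    case False
    moreover have "vs \<noteq> []" using vs by auto
    ultimately show ?thesis
      using assms(2) by (intro exI[of _ "[]"] exI[of _ vs]) (auto simp: cycle_edges_conv_path_edges)
  qed
  then obtain xs ys where split: "vs = xs @ ys" "ys @ xs \<noteq> []"
    and e: "e = {hd (ys @ xs), last (ys @ xs)}" by blast
  have "distinct (ys @ xs)" "3 \<le> length (ys @ xs)" using vs split by auto
  then have "e \<notin> path_edges (ys @ xs)" unfolding e by (rule ends_notin_path_edges)
  moreover have "cycle_edges vs = insert e (path_edges (ys @ xs))"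
    unfolding split(1) cycle_edges_append_commute[of xs] cycle_edges_conv_path_edges[OF split(2)]
    by (simp add: e insert_commute)
  ultimately have "cycle_edges vs - {e} = path_edges (ys @ xs)" by simp
  with split show ?thesis by (intro that[of "ys @ xs"]) auto
qed


section \<open>Trees and blocks\<close>

text \<open>Acyclicity is replaced by an edge count.\<close>

definition tree_basis :: "'a set \<Rightarrow> 'a set set \<Rightarrow> 'a set set \<Rightarrow> bool" where
  "tree_basis V E B \<longleftrightarrow> B \<subseteq> E \<and> graph_connected V B \<and> card B = card V - 1"

lemma tree_basisI:
  assumes "simple_graph V E" "B \<subseteq> E" "graph_connected V B" "card B \<le> card V - 1"
  shows "tree_basis V E B"
  using assms connected_card_edges_ge[OF simple_graph_mono[OF assms(1,2)]]
  unfolding tree_basis_def by simp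

lemma tree_basisD:
  assumes "tree_basis V E B"
  shows "B \<subseteq> E" "graph_connected V B" "card B = card V - 1"
  using assms unfolding tree_basis_def by auto

lemma tree_basis_finite: "simple_graph V E \<Longrightarrow> tree_basis V E B \<Longrightarrow> finite B"
  using simple_graph_finite_edges finite_subset tree_basisD(1) by metis

lemma tree_basis_edge_bridge:
  assumes "simple_graph V E" "tree_basis V E B" "{a, b} \<in> B"
  shows "(a, b) \<notin> reach (B - {{a, b}})"
proof
  let ?B = "B - {{a, b}}"
  note B = tree_basisD[OF assms(2)]
  assume ab: "(a, b) \<in> reach ?B"
  have "(c, d) \<in> reach ?B" if "{c, d} \<in> B" for c d
  proof (cases "{c, d} = {a, b}")
    case True
    then have "c = a \<and> d = b \<or> c = b \<and> d = a" by (simp add: doubleton_eq_iff)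
    then show ?thesis using ab reach_sym[OF ab] by (elim disjE) simp_all
  next
    case False
    then show ?thesis using that by (intro reach_edge) simp
  qed
  then have "graph_connected V ?B" using graph_connected_replace[OF B(2)] by blast
  moreover have "simple_graph V ?B" using assms(1) B(1) by (blast intro: simple_graph_mono)
  ultimately have "card V - 1 \<le> card ?B" using connected_card_edges_ge by blast
  moreover have "card ?B < card B"
    using tree_basis_finite[OF assms(1,2)] assms(3) by (rule card_Diff1_less)
  ultimately show False using B(3) by simp
qed

lemma tree_basis_imp_spanning_tree:
  assumes "simple_graph V E" "tree_basis V E B"
  shows "spanning_tree V E B"
proof -
  have "\<not> is_cycle B vs" for vs
  proof
    assume cycle: "is_cycle B vs"
    then have "vs \<noteq> []" "cycle_edges vs \<subseteq> B" unfolding is_cycle_def by auto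
    let ?e = "{last vs, hd vs}"
    have e: "?e \<in> cycle_edges vs" using cycle_edges_conv_path_edges[OF \<open>vs \<noteq> []\<close>] by simp
    obtain P where P: "set P = set vs" "cycle_edges vs - {?e} = path_edges P"
      using cycle_remove_edge_path[OF cycle e] by metis
    have "(last vs, hd vs) \<in> reach (path_edges P)"
      using P(1) \<open>vs \<noteq> []\<close> by (intro graph_connectedD[OF graph_connected_path]) auto
    then have "(last vs, hd vs) \<in> reach (B - {?e})"
      using P(2) \<open>cycle_edges vs \<subseteq> B\<close> by (blast intro: reach_mono)
    then show False
      using tree_basis_edge_bridge[OF assms] e \<open>cycle_edges vs \<subseteq> B\<close> by blast
  qed
  then show ?thesis using tree_basisD[OF assms(2)] unfolding spanning_tree_def by blast
qed

lemma tree_basis_replace_edge: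
  assumes "simple_graph V E" "tree_basis V E B" "e \<in> B" "x \<in> E - B"
    and "graph_connected V (insert x (B - {e}))"
  shows "tree_basis V E (insert x (B - {e}))"
proof (rule tree_basisI[OF assms(1) _ assms(5)])
  note B = tree_basisD[OF assms(2)]
  have "finite B" using assms(1,2) by (rule tree_basis_finite)
  then show "card (insert x (B - {e})) \<le> card V - 1"
    using assms(3,4) B(3) card_Suc_Diff1[of B e] by simp
  show "insert x (B - {e}) \<subseteq> E" using assms(4) B(1) by blast
qed

lemma tree_basis_exchange:
  assumes "simple_graph V E" "tree_basis V E B" "tree_basis V E B'" "x \<in> B' - B"
  obtains e where "e \<in> B - B'" "tree_basis V E (insert x (B - {e}))"
proof -
  have "x \<in> E" using assms(3,4) tree_basisD(1) by blast
  then have "x \<subseteq> V" "card x = 2" using assms(1) unfolding simple_graph_def by auto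
  then obtain a b where x: "x = {a, b}" "a \<in> V" "b \<in> V" by (auto simp: card_2_iff)
  have "(a, b) \<notin> reach (B' - {x})"
    using tree_basis_edge_bridge[OF assms(1,3)] assms(4) x(1) by blast
  moreover have "(a, b) \<in> reach B"
    using graph_connectedD[OF tree_basisD(2)[OF assms(2)] x(2,3)] .
  ultimately obtain e where e: "e \<in> B - (B' - {x})"
    and bypass: "\<And>A. B - {e} \<subseteq> A \<Longrightarrow> (a, b) \<in> reach A \<Longrightarrow> graph_connected V A"
    using connected_replaceable_edge[OF tree_basisD(2)[OF assms(2)] subset_refl] by metis
  have "(a, b) \<in> reach (insert x (B - {e}))" unfolding x(1) by (rule reach_edge) simp
  then have "graph_connected V (insert x (B - {e}))" by (intro bypass) auto
  then have "tree_basis V E (insert x (B - {e}))"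
    using tree_basis_replace_edge[OF assms(1,2)] e assms(4) \<open>x \<in> E\<close> by blast
  then show ?thesis using that e assms(4) by blast
qed

definition exchangeable :: "'a set \<Rightarrow> 'a set set \<Rightarrow> 'a set \<Rightarrow> 'a set \<Rightarrow> bool" where
  "exchangeable V E e f \<longleftrightarrow>
    (\<exists>X. e \<notin> X \<and> f \<notin> X \<and> tree_basis V E (insert e X) \<and> tree_basis V E (insert f X))"

text \<open>This relation stands in for \<^const>\<open>same_block\<close>, whose transitivity is then not needed.\<close>

abbreviation exchange_equiv :: "'a set \<Rightarrow> 'a set set \<Rightarrow> 'a set \<Rightarrow> 'a set \<Rightarrow> bool" where
  "exchange_equiv V E \<equiv> (exchangeable V E)\<^sup>*\<^sup>*"

lemma exchange_equiv_sym: "exchange_equiv V E e f \<Longrightarrow> exchange_equiv V E f e"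
proof (rule sympD[OF symp_rtranclp])
  show "symp (exchangeable V E)" unfolding exchangeable_def by (rule sympI) blast
qed

lemma cycle_remove_edge_extends_to_tree_basis:
  assumes "simple_graph V E" "graph_connected V E" "is_cycle E vs"
  obtains Q where "\<And>e. e \<in> cycle_edges vs \<Longrightarrow>
    tree_basis V E ((cycle_edges vs - {e}) \<union> Q) \<and> (cycle_edges vs - {e}) \<inter> Q = {}"
proof -
  let ?C = "cycle_edges vs"
  have vs: "3 \<le> length vs" "distinct vs" "?C \<subseteq> E" using assms(3) unfolding is_cycle_def by auto
  have "\<Union> ?C \<subseteq> V" using vs(3) assms(1) unfolding simple_graph_def by blast
  moreover have "set vs \<subseteq> \<Union> ?C" unfolding cycle_edges_def by (auto simp: set_conv_nth)
  ultimately have "set vs \<subseteq> V" by blast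
  moreover have "set vs \<noteq> {}" using vs(1) by auto
  ultimately obtain Q where Q: "Q \<subseteq> E" "card Q \<le> card V - card (set vs)"
    and connects: "\<And>A. graph_connected (set vs) A \<Longrightarrow> graph_connected V (A \<union> Q)"
    using connected_extension[OF assms(1,2)] by metis
  have "finite Q" "finite V"
    using Q(1) assms(1) simple_graph_finite_edges finite_subset unfolding simple_graph_def by blast+
  have "length vs = card (set vs)" "card (set vs) \<le> card V"
    using vs(2) distinct_card card_mono[OF \<open>finite V\<close> \<open>set vs \<subseteq> V\<close>] by fastforce+
  then have card_Q: "(length vs - 1) + card Q \<le> card V - 1" using Q(2) vs(1) by linarith
  have "tree_basis V E ((?C - {e}) \<union> Q) \<and> (?C - {e}) \<inter> Q = {}" if "e \<in> ?C" for e
  proof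
    obtain P where P: "set P = set vs" "length P = length vs" "?C - {e} = path_edges P"
      using cycle_remove_edge_path[OF assms(3) \<open>e \<in> ?C\<close>] .
    have "graph_connected V ((?C - {e}) \<union> Q)"
      using connects[OF graph_connected_path[of P, unfolded P(1)]] P(3) by simp
    moreover have "card (?C - {e}) + card Q \<le> card V - 1"
      using card_path_edges_le[of P] P(2,3) card_Q by simp
    moreover have sum: "card (?C - {e}) + card Q = card ((?C - {e}) \<union> Q) + card ((?C - {e}) \<inter> Q)"
      using P(3) \<open>finite Q\<close> by (intro card_Un_Int) auto
    ultimately show basis: "tree_basis V E ((?C - {e}) \<union> Q)"
      using vs(3) Q(1) by (intro tree_basisI assms(1)) auto
    then have "card ((?C - {e}) \<inter> Q) = 0"
      using tree_basisD(3)[OF basis] sum \<open>card (?C - {e}) + card Q \<le> card V - 1\<close> by linarith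
    then show "(?C - {e}) \<inter> Q = {}" using \<open>finite Q\<close> by simp
  qed
  then show ?thesis by (rule that)
qed

lemma same_block_imp_exchange_equiv:
  assumes "simple_graph V E" "graph_connected V E" "same_block E e f"
  shows "exchange_equiv V E e f"
proof (cases "e = f")
  case False
  then obtain vs where cycle: "is_cycle E vs" and ef: "e \<in> cycle_edges vs" "f \<in> cycle_edges vs"
    using assms(3) unfolding same_block_def by blast
  obtain Q where Q: "\<And>g. g \<in> cycle_edges vs \<Longrightarrow>
      tree_basis V E ((cycle_edges vs - {g}) \<union> Q) \<and> (cycle_edges vs - {g}) \<inter> Q = {}"
    using cycle_remove_edge_extends_to_tree_basis[OF assms(1,2) cycle] by blast
  let ?X = "(cycle_edges vs - {e, f}) \<union> Q"
  have "insert e ?X = (cycle_edges vs - {f}) \<union> Q" "insert f ?X = (cycle_edges vs - {e}) \<union> Q"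
    using ef False by auto
  moreover have "e \<notin> ?X" "f \<notin> ?X" using Q ef False by blast+
  ultimately have "exchangeable V E e f" unfolding exchangeable_def using Q ef by metis
  then show ?thesis by blast
qed simp

text \<open>The witness \<open>x\<close> closes a fundamental cycle through \<open>e\<close> and \<open>f\<close>.\<close>

definition share_circuit ::
    "'a set \<Rightarrow> 'a set set \<Rightarrow> 'a set set \<Rightarrow> 'a set \<Rightarrow> 'a set \<Rightarrow> bool" where
  "share_circuit V E B e f \<longleftrightarrow> e \<in> B \<and> f \<in> B \<and> (\<exists>x\<in>E - B.
    graph_connected V (insert x (B - {e})) \<and> graph_connected V (insert x (B - {f})))"

lemma within_share_circuit_sym:
  assumes "within_steps (share_circuit V E B) d e f"
  shows "within_steps (share_circuit V E B) d f e"
  by (rule within_steps_reverse[OF assms TrueI]) (auto simp: share_circuit_def)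

definition block_diameter_le :: "'a set \<Rightarrow> 'a set set \<Rightarrow> 'a set set \<Rightarrow> nat \<Rightarrow> bool" where
  "block_diameter_le V E B d \<longleftrightarrow>
    (\<forall>e\<in>B. \<forall>f\<in>B. exchange_equiv V E e f \<longrightarrow> within_steps (share_circuit V E B) d e f)"

lemma block_diameter_le_mono:
  "block_diameter_le V E B d \<Longrightarrow> d \<le> d' \<Longrightarrow> block_diameter_le V E B d'"
  unfolding block_diameter_le_def by (blast intro: within_steps_mono)


section \<open>Splitting at a cut vertex\<close>

locale vertex_cut =
  fixes V :: "'a set" and E :: "'a set set" and V\<^sub>1 V\<^sub>2 :: "'a set" and s :: 'a
  assumes simple: "simple_graph V E"
    and vertices: "V = V\<^sub>1 \<union> V\<^sub>2" "V\<^sub>1 \<inter> V\<^sub>2 = {s}"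
    and edges: "E \<subseteq> induced_edges E V\<^sub>1 \<union> induced_edges E V\<^sub>2"
begin

abbreviation "E\<^sub>1 \<equiv> induced_edges E V\<^sub>1"
abbreviation "E\<^sub>2 \<equiv> induced_edges E V\<^sub>2"

lemma flipped: "vertex_cut V E V\<^sub>2 V\<^sub>1 s"
  using simple vertices edges by unfold_locales auto

lemma simple_side: "simple_graph V\<^sub>1 E\<^sub>1"
  using simple_graph_induced[OF simple] vertices(1) by blast

lemma sides_disjoint: "E\<^sub>1 \<inter> E\<^sub>2 = {}"
proof -
  have "e \<subseteq> {s}" "card e = 2" if "e \<in> E\<^sub>1 \<inter> E\<^sub>2" for e
    using that vertices(2) simple unfolding induced_edges_def simple_graph_def by blast+
  then show ?thesis by (fastforce simp: subset_singleton_iff)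
qed

lemma card_vertices: "card V - 1 = (card V\<^sub>1 - 1) + (card V\<^sub>2 - 1)"
proof -
  have finite: "finite V\<^sub>1" "finite V\<^sub>2" using simple vertices(1) unfolding simple_graph_def by auto
  moreover have "V\<^sub>1 \<noteq> {}" "V\<^sub>2 \<noteq> {}" using vertices(2) by auto
  ultimately have "0 < card V\<^sub>1" "0 < card V\<^sub>2" by (auto simp: card_gt_0_iff)
  moreover have "card V\<^sub>1 + card V\<^sub>2 = card V + 1" using card_Un_Int[OF finite] vertices by simp
  ultimately show ?thesis by linarith
qed

lemma induced_connected:
  assumes "graph_connected V A" "A \<subseteq> E"
  shows "graph_connected V\<^sub>1 (induced_edges A V\<^sub>1)"
proof -
  define collapse where "collapse v = (if v \<in> V\<^sub>1 then v else s)" for v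
  have collapsed: "(collapse u, collapse v) \<in> reach (induced_edges A V\<^sub>1)"
    if "(u, v) \<in> reach A" for u v
    using that
  proof (induction rule: reach_induct)
    case (step y z)
    then consider "{y, z} \<in> E\<^sub>1" | "{y, z} \<in> E\<^sub>2" using assms(2) edges by blast
    then have "(collapse y, collapse z) \<in> reach (induced_edges A V\<^sub>1)"
    proof cases
      case 1
      then show ?thesis
        using step(2) unfolding collapse_def induced_edges_def by (auto intro!: reach_edge)
    next
      case 2
      then have "collapse y = s" "collapse z = s"
        using vertices unfolding collapse_def induced_edges_def by auto
      then show ?thesis by simp
    qed
    with step.IH show ?case by (rule reach_trans)
  qed simp
  show ?thesis
    unfolding graph_connected_iff_reach
  proof (intro ballI)
    fix u v assume uv: "u \<in> V\<^sub>1" "v \<in> V\<^sub>1"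
    then have "(u, v) \<in> reach A"
      using vertices(1) by (intro graph_connectedD[OF assms(1)]) auto
    from collapsed[OF this] show "(u, v) \<in> reach (induced_edges A V\<^sub>1)"
      using uv by (simp add: collapse_def)
  qed
qed

lemma union_tree_basis:
  assumes "tree_basis V\<^sub>1 E\<^sub>1 B\<^sub>1" "tree_basis V\<^sub>2 E\<^sub>2 B\<^sub>2"
  shows "tree_basis V E (B\<^sub>1 \<union> B\<^sub>2)"
proof (rule tree_basisI[OF simple])
  note B = tree_basisD[OF assms(1)] tree_basisD[OF assms(2)]
  show "B\<^sub>1 \<union> B\<^sub>2 \<subseteq> E" using B(1,4) unfolding induced_edges_def by blast
  show "graph_connected V (B\<^sub>1 \<union> B\<^sub>2)"
    using graph_connected_Un[OF B(2,5)] vertices by simp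
  show "card (B\<^sub>1 \<union> B\<^sub>2) \<le> card V - 1" using card_Un_le[of B\<^sub>1 B\<^sub>2] B(3,6) card_vertices by simp
qed

lemma induced_tree_basis:
  assumes "tree_basis V E A"
  shows "tree_basis V\<^sub>1 E\<^sub>1 (induced_edges A V\<^sub>1)"
proof (rule tree_basisI[OF simple_side])
  note A = tree_basisD[OF assms]
  have subset: "induced_edges A V\<^sub>1 \<subseteq> E\<^sub>1" "induced_edges A V\<^sub>2 \<subseteq> E\<^sub>2"
    using A(1) unfolding induced_edges_def by auto
  then have "induced_edges A V\<^sub>1 \<inter> induced_edges A V\<^sub>2 = {}" using sides_disjoint by blast
  moreover have "A = induced_edges A V\<^sub>1 \<union> induced_edges A V\<^sub>2"
    using A(1) edges unfolding induced_edges_def by blast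
  ultimately have "card A = card (induced_edges A V\<^sub>1) + card (induced_edges A V\<^sub>2)"
    using tree_basis_finite[OF simple assms] by (metis card_Un_disjoint finite_Un)
  moreover have "card V\<^sub>2 - 1 \<le> card (induced_edges A V\<^sub>2)"
    using vertex_cut.induced_connected[OF flipped A(2,1)]
      simple_graph_mono[OF vertex_cut.simple_side[OF flipped] subset(2)]
    by (intro connected_card_edges_ge)
  ultimately show "card (induced_edges A V\<^sub>1) \<le> card V\<^sub>1 - 1" using A(3) card_vertices by linarith
  show "graph_connected V\<^sub>1 (induced_edges A V\<^sub>1)" by (rule induced_connected[OF A(2,1)])
  show "induced_edges A V\<^sub>1 \<subseteq> E\<^sub>1" by (rule subset)
qed

text \<open>All tree bases have equally many edges in \<open>E\<^sub>1\<close>, so an exchange cannot cross the cut.\<close>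

lemma exchangeable_restrict:
  assumes "exchangeable V E e f" "e \<in> E\<^sub>1"
  shows "f \<in> E\<^sub>1 \<and> exchangeable V\<^sub>1 E\<^sub>1 e f"
proof -
  obtain X where X: "e \<notin> X" "f \<notin> X" "tree_basis V E (insert e X)" "tree_basis V E (insert f X)"
    using assms(1) unfolding exchangeable_def by blast
  let ?X\<^sub>1 = "induced_edges X V\<^sub>1"
  have "e \<subseteq> V\<^sub>1" using assms(2) unfolding induced_edges_def by blast
  then have e: "tree_basis V\<^sub>1 E\<^sub>1 (insert e ?X\<^sub>1)" "e \<notin> ?X\<^sub>1"
    using induced_tree_basis[OF X(3)] X(1) induced_edges_subset[of X]
    by (auto simp: induced_edges_insert)
  have "f \<subseteq> V\<^sub>1"
  proof (rule ccontr)
    assume "\<not> f \<subseteq> V\<^sub>1"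
    then have "induced_edges (insert f X) V\<^sub>1 = ?X\<^sub>1" by (simp add: induced_edges_insert)
    then have "card ?X\<^sub>1 = card (insert e ?X\<^sub>1)"
      using tree_basisD(3)[OF e(1)] tree_basisD(3)[OF induced_tree_basis[OF X(4)]] by simp
    moreover have "finite ?X\<^sub>1" using tree_basis_finite[OF simple_side e(1)] by simp
    ultimately show False using e(2) by simp
  qed
  then have f: "tree_basis V\<^sub>1 E\<^sub>1 (insert f ?X\<^sub>1)" "f \<notin> ?X\<^sub>1"
    using induced_tree_basis[OF X(4)] X(2) induced_edges_subset[of X]
    by (auto simp: induced_edges_insert)
  show ?thesis using e f tree_basisD(1)[OF f(1)] unfolding exchangeable_def by blast
qed

lemma exchange_equiv_restrict:
  assumes "exchange_equiv V E e f" "e \<in> E\<^sub>1"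
  shows "f \<in> E\<^sub>1 \<and> exchange_equiv V\<^sub>1 E\<^sub>1 e f"
  using assms
proof (induction rule: rtranclp_induct)
  case (step f g)
  then have f: "f \<in> E\<^sub>1" "exchange_equiv V\<^sub>1 E\<^sub>1 e f" by auto
  then show ?case
    using exchangeable_restrict[OF step.hyps(2)] by (auto intro: rtranclp.rtrancl_into_rtrancl)
qed simp

lemma share_circuit_union:
  assumes "tree_basis V\<^sub>1 E\<^sub>1 B\<^sub>1" "tree_basis V\<^sub>2 E\<^sub>2 B\<^sub>2"
  shows "share_circuit V\<^sub>1 E\<^sub>1 B\<^sub>1 \<le> share_circuit V E (B\<^sub>1 \<union> B\<^sub>2)"
proof (intro predicate2I)
  fix e f assume "share_circuit V\<^sub>1 E\<^sub>1 B\<^sub>1 e f"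
  then obtain x where ef: "e \<in> B\<^sub>1" "f \<in> B\<^sub>1" and x: "x \<in> E\<^sub>1 - B\<^sub>1"
    and connected: "graph_connected V\<^sub>1 (insert x (B\<^sub>1 - {e}))"
      "graph_connected V\<^sub>1 (insert x (B\<^sub>1 - {f}))"
    unfolding share_circuit_def by blast
  have subset: "B\<^sub>1 \<subseteq> E\<^sub>1" "B\<^sub>2 \<subseteq> E\<^sub>2" using assms tree_basisD(1) by auto
  have lift: "graph_connected V (insert x (B\<^sub>1 \<union> B\<^sub>2 - {g}))"
    if "g \<in> B\<^sub>1" "graph_connected V\<^sub>1 (insert x (B\<^sub>1 - {g}))" for g
  proof -
    have "insert x (B\<^sub>1 - {g}) \<union> B\<^sub>2 = insert x (B\<^sub>1 \<union> B\<^sub>2 - {g})"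
      using that(1) subset sides_disjoint by auto
    then show ?thesis
      using graph_connected_Un[OF that(2) tree_basisD(2)[OF assms(2)]] vertices by simp
  qed
  have "x \<in> E - (B\<^sub>1 \<union> B\<^sub>2)" using x subset sides_disjoint induced_edges_subset by blast
  then show "share_circuit V E (B\<^sub>1 \<union> B\<^sub>2) e f"
    unfolding share_circuit_def by (intro conjI bexI[of _ x] UnI1 ef lift connected)
qed

lemma union_block_distance:
  assumes "tree_basis V\<^sub>1 E\<^sub>1 B\<^sub>1" "tree_basis V\<^sub>2 E\<^sub>2 B\<^sub>2" "block_diameter_le V\<^sub>1 E\<^sub>1 B\<^sub>1 d"
    and "e \<in> B\<^sub>1" "f \<in> B\<^sub>1 \<union> B\<^sub>2" "exchange_equiv V E e f"
  shows "within_steps (share_circuit V E (B\<^sub>1 \<union> B\<^sub>2)) d e f"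
proof -
  have subset: "B\<^sub>1 \<subseteq> E\<^sub>1" "B\<^sub>2 \<subseteq> E\<^sub>2" using assms tree_basisD(1) by auto
  have "f \<in> E\<^sub>1" "exchange_equiv V\<^sub>1 E\<^sub>1 e f"
    using exchange_equiv_restrict[OF assms(6)] assms(4) subset(1) by auto
  moreover from this have "f \<in> B\<^sub>1" using assms(5) subset(2) sides_disjoint by blast
  ultimately have "within_steps (share_circuit V\<^sub>1 E\<^sub>1 B\<^sub>1) d e f"
    using assms(3,4) unfolding block_diameter_le_def by blast
  then show ?thesis using share_circuit_union[OF assms(1,2)] by (rule within_steps_rel_mono)
qed

lemma union_block_diameter:
  assumes "tree_basis V\<^sub>1 E\<^sub>1 B\<^sub>1" "block_diameter_le V\<^sub>1 E\<^sub>1 B\<^sub>1 d"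
    and "tree_basis V\<^sub>2 E\<^sub>2 B\<^sub>2" "block_diameter_le V\<^sub>2 E\<^sub>2 B\<^sub>2 d"
  shows "block_diameter_le V E (B\<^sub>1 \<union> B\<^sub>2) d"
  unfolding block_diameter_le_def
proof (intro ballI impI)
  fix e f assume ef: "e \<in> B\<^sub>1 \<union> B\<^sub>2" "f \<in> B\<^sub>1 \<union> B\<^sub>2" "exchange_equiv V E e f"
  show "within_steps (share_circuit V E (B\<^sub>1 \<union> B\<^sub>2)) d e f"
  proof (cases "e \<in> B\<^sub>1")
    case True
    then show ?thesis using union_block_distance[OF assms(1,3,2)] ef(2,3) by blast
  next
    case False
    then have "e \<in> B\<^sub>2" "f \<in> B\<^sub>2 \<union> B\<^sub>1" using ef by auto
    then show ?thesis
      using vertex_cut.union_block_distance[OF flipped assms(3,1,4)] ef(3)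
      by (simp add: Un_commute)
  qed
qed

end


section \<open>Balanced ears\<close>

definition component :: "'a set set \<Rightarrow> 'a set \<Rightarrow> 'a \<Rightarrow> 'a set" where
  "component E S v = {w. (v, w) \<in> reach (induced_edges E (- S))}"

definition attachments :: "'a set set \<Rightarrow> 'a set \<Rightarrow> 'a set \<Rightarrow> 'a set" where
  "attachments E S K = {y \<in> S. \<exists>z\<in>K. {y, z} \<in> E}"

lemma component_self: "v \<in> component E S v"
  unfolding component_def by simp

lemma component_least:
  assumes "v \<in> K" "\<And>z y. z \<in> K \<Longrightarrow> {z, y} \<in> E \<Longrightarrow> z \<notin> S \<Longrightarrow> y \<notin> S \<Longrightarrow> y \<in> K"
  shows "component E S v \<subseteq> K"
proof
  fix w assume "w \<in> component E S v"
  then have "(v, w) \<in> reach (induced_edges E (- S))" unfolding component_def by simp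
  then show "w \<in> K"
    using assms(1) by (rule reach_closed) (use assms(2) in \<open>auto simp: induced_edges_def\<close>)
qed

lemma component_disjoint: "v \<notin> S \<Longrightarrow> component E S v \<inter> S = {}"
  using component_least[of v "- S"] by blast

lemma component_closed:
  assumes "z \<in> component E S v" "{z, y} \<in> E" "v \<notin> S" "y \<notin> S"
  shows "y \<in> component E S v"
proof -
  have "z \<notin> S" using component_disjoint[OF assms(3)] assms(1) by blast
  then have "(z, y) \<in> reach (induced_edges E (- S))"
    using assms(2,4) by (intro reach_edge) (simp add: induced_edges_def)
  then show ?thesis using assms(1) unfolding component_def by (blast intro: reach_trans)
qed

lemma component_eq: "z \<in> component E S v \<Longrightarrow> component E S z = component E S v"
  unfolding component_def by (blast intro: reach_sym reach_trans)

lemma component_antimono: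
  assumes "S \<subseteq> S'"
  shows "component E S' v \<subseteq> component E S v"
proof -
  have "induced_edges E (- S') \<subseteq> induced_edges E (- S)"
    using assms by (intro induced_edges_mono) blast
  then show ?thesis unfolding component_def by (auto elim: reach_mono)
qed

lemma component_path:
  assumes "x \<in> component E S v" "y \<in> component E S v"
  obtains R where "is_path E R" "hd R = x" "last R = y" "set R \<subseteq> component E S v"
proof -
  have "y \<in> component E S x" using assms component_eq[OF assms(1)] by simp
  then obtain R where R: "is_path (induced_edges E (- S)) R" "hd R = x" "last R = y"
    unfolding component_def by (auto elim: reach_imp_path)
  have "(x, z) \<in> reach (induced_edges E (- S))" if "z \<in> set R" for z
    using reach_mono[OF reach_path_edges[OF that]] R(1,2) unfolding is_path_def by simp
  then have "set R \<subseteq> component E S x" unfolding component_def by blast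
  then have "set R \<subseteq> component E S v" using component_eq[OF assms(1)] by simp
  moreover have "is_path E R" using R(1) induced_edges_subset unfolding is_path_def by blast
  ultimately show ?thesis using that R(2,3) by blast
qed

lemma list_split_consecutive:
  assumes "u \<in> set L" "w \<in> set L" "u \<noteq> w" "u \<in> Q" "w \<in> Q"
  obtains xs a ys b zs where "L = xs @ a # ys @ b # zs" "a \<in> Q" "b \<in> Q" "set ys \<inter> Q = {}"
proof -
  obtain xs a L' where L: "L = xs @ a # L'" "a \<in> Q" "\<forall>x\<in>set xs. x \<notin> Q"
    using split_list_first_prop[of L "\<lambda>x. x \<in> Q"] assms by blast
  then have "\<exists>x\<in>set L'. x \<in> Q" using assms by auto
  then obtain ys b zs where "L' = ys @ b # zs" "b \<in> Q" "\<forall>x\<in>set ys. x \<notin> Q"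
    using split_list_first_prop[of L' "\<lambda>x. x \<in> Q"] by blast
  then show ?thesis using L by (intro that[of xs a ys b zs]) auto
qed

definition ear :: "'a set set \<Rightarrow> 'a set \<Rightarrow> 'a set \<Rightarrow> 'a list \<Rightarrow> bool" where
  "ear E S K L \<longleftrightarrow> is_path E L \<and> hd L \<in> S \<and> last L \<in> S \<and>
    set L \<subseteq> {hd L, last L} \<union> K \<and> set L \<inter> K \<noteq> {}"

lemma ear_append:
  assumes "ear E S K (P @ Q)" "P \<noteq> []" "Q \<noteq> []"
  shows "is_path E P" "hd P \<in> S" "set P \<subseteq> insert (hd P) K"
    and "is_path E Q" "last Q \<in> S" "set Q \<subseteq> insert (last Q) K"
    and "set P \<inter> set Q = {}"
proof -
  have path: "is_path E P" "is_path E Q" "set P \<inter> set Q = {}"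
    and ends: "hd P \<in> S" "last Q \<in> S"
    and subset: "set P \<union> set Q \<subseteq> {hd P, last Q} \<union> K"
    using assms unfolding ear_def by (auto simp: is_path_append)
  have "hd P \<in> set P" "last Q \<in> set Q" using assms by auto
  then show "set P \<subseteq> insert (hd P) K" "set Q \<subseteq> insert (last Q) K"
    using path(3) subset by blast+
  show "is_path E P" "hd P \<in> S" "is_path E Q" "last Q \<in> S" "set P \<inter> set Q = {}"
    by (fact path ends)+
qed

lemma ear_through_component:
  assumes v: "v \<notin> T" and subset: "component E T v \<subseteq> K"
    and P: "is_path E P" "hd P \<in> S" "set P \<subseteq> insert (hd P) K"
    and Q: "is_path E Q" "last Q \<in> S" "set Q \<subseteq> insert (last Q) K"
    and disjoint: "set P \<inter> set Q = {}" and covered: "set P \<union> set Q \<subseteq> T"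
    and attached: "last P \<in> attachments E T (component E T v)"
      "hd Q \<in> attachments E T (component E T v)"
  shows "\<exists>L. ear E S K L \<and> set L \<inter> component E T v \<noteq> {} \<and> set P \<union> set Q \<subseteq> set L"
proof -
  let ?C = "component E T v"
  obtain x y where "x \<in> ?C" "y \<in> ?C" and edges: "{last P, x} \<in> E" "{hd Q, y} \<in> E"
    using attached unfolding attachments_def by blast
  then obtain R where R: "is_path E R" "hd R = x" "last R = y" "set R \<subseteq> ?C"
    using component_path by metis
  have nonempty: "P \<noteq> []" "Q \<noteq> []" "R \<noteq> []" using P(1) Q(1) R(1) unfolding is_path_def by auto
  have "set R \<inter> (set P \<union> set Q) = {}"
    using R(4) component_disjoint[OF v] covered by blast
  then have "is_path E (P @ R @ Q)"
    using P(1) Q(1) R(1-3) nonempty disjoint edges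
    by (auto simp: is_path_append insert_commute)
  moreover have "set R \<inter> ?C \<noteq> {}" using R(4) nonempty(3) by (cases R) auto
  moreover have "set (P @ R @ Q) \<subseteq> {hd P, last Q} \<union> K" using P(3) Q(3) R(4) subset by auto
  ultimately have "ear E S K (P @ R @ Q)" "set (P @ R @ Q) \<inter> ?C \<noteq> {}"
    using P(2) Q(2) subset nonempty unfolding ear_def by auto
  then show ?thesis by (intro exI[of _ "P @ R @ Q"]) auto
qed

lemma ear_reroute_between:
  fixes E S L v
  defines "C \<equiv> component E (S \<union> set L) v"
  assumes ear: "ear E S K L" and v: "v \<notin> S \<union> set L" and subset: "C \<subseteq> K"
    and split: "L = xs @ a # ys @ b # zs"
    and ab: "a \<in> attachments E (S \<union> set L) C" "b \<in> attachments E (S \<union> set L) C"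
  shows "\<exists>L'. ear E S K L' \<and> set L' \<inter> C \<noteq> {} \<and> set (xs @ [a]) \<union> set (b # zs) \<subseteq> set L'"
proof -
  have "ear E S K ((xs @ [a]) @ (ys @ b # zs))" "ear E S K ((xs @ a # ys) @ (b # zs))"
    using ear split by auto
  note prefix = ear_append(1-3)[OF this(1)] and suffix = ear_append(4-6)[OF this(2)]
  have "distinct L" using ear unfolding ear_def is_path_def by blast
  then have disjoint: "set (xs @ [a]) \<inter> set (b # zs) = {}" unfolding split by auto
  have "set (xs @ [a]) \<union> set (b # zs) \<subseteq> S \<union> set L" unfolding split by auto
  from ear_through_component[OF v subset[unfolded C_def] prefix suffix disjoint this]
  show ?thesis using ab unfolding C_def by simp
qed

lemma ear_reroute_end:
  fixes E S L v
  defines "C \<equiv> component E (S \<union> set L) v"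
  assumes ear: "ear E S K L" and v: "v \<notin> S \<union> set L" and subset: "C \<subseteq> K"
    and y: "y \<in> set L - S" "y \<in> attachments E (S \<union> set L) C"
    and h: "h \<in> S - set L" "h \<in> attachments E (S \<union> set L) C"
  shows "\<exists>L'. ear E S K L' \<and> set L' \<inter> C \<noteq> {} \<and> y \<in> set L'"
proof -
  obtain xs zs where split: "L = (xs @ [y]) @ zs" using y(1) by (auto dest: split_list)
  then have "zs \<noteq> []" using ear y(1) unfolding ear_def by auto
  note prefix = ear_append(1-3)[OF ear[unfolded split] _ this]
  have suffix: "is_path E [h]" "last [h] \<in> S" "set [h] \<subseteq> insert (last [h]) K"
    using h(1) by (auto simp: is_path_def)
  have "set (xs @ [y]) \<inter> set [h] = {}" "set (xs @ [y]) \<union> set [h] \<subseteq> S \<union> set L"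
    using h(1) unfolding split by auto
  from ear_through_component[OF v subset[unfolded C_def] prefix suffix this]
  show ?thesis using y(2) h(2) unfolding C_def by auto
qed

locale nonseparable =
  fixes V :: "'a set" and E :: "'a set set"
  assumes simple: "simple_graph V E"
    and connected: "graph_connected V E"
    and no_cut: "\<And>V\<^sub>1 V\<^sub>2 s. vertex_cut V E V\<^sub>1 V\<^sub>2 s \<Longrightarrow> V\<^sub>1 = V \<or> V\<^sub>2 = V"
begin

lemma finite_vertices: "finite V"
  using simple unfolding simple_graph_def by simp

lemma component_subset: "v \<in> V \<Longrightarrow> component E S v \<subseteq> V"
  using simple by (intro component_least) (auto simp: simple_graph_def)

lemma finite_component: "v \<in> V \<Longrightarrow> finite (component E S v)"
  using component_subset finite_vertices by (rule finite_subset)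

lemma component_cut:
  assumes "v \<in> V - S" "s \<in> S" "S \<subseteq> V" "attachments E S (component E S v) \<subseteq> {s}"
  shows "vertex_cut V E (insert s (component E S v)) (V - component E S v) s"
proof
  let ?K = "component E S v"
  have disjoint: "?K \<inter> S = {}" using assms(1) by (intro component_disjoint) simp
  have "?K \<subseteq> V" using assms(1) component_subset by blast
  then show "V = insert s ?K \<union> (V - ?K)" "insert s ?K \<inter> (V - ?K) = {s}"
    using assms(2,3) disjoint by auto
  show "E \<subseteq> induced_edges E (insert s ?K) \<union> induced_edges E (V - ?K)"
  proof
    fix e assume "e \<in> E"
    then have e: "e \<subseteq> V" "card e = 2" using simple unfolding simple_graph_def by auto
    show "e \<in> induced_edges E (insert s ?K) \<union> induced_edges E (V - ?K)"
    proof (cases "e \<inter> ?K = {}")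
      case True
      then show ?thesis using \<open>e \<in> E\<close> e(1) unfolding induced_edges_def by blast
    next
      case False
      then obtain z y where zy: "e = {z, y}" "z \<in> ?K" using e(2) by (auto simp: card_2_iff)
      have "y \<in> insert s ?K"
      proof (cases "y \<in> S")
        case True
        then have "y \<in> attachments E S ?K"
          using \<open>e \<in> E\<close> zy unfolding attachments_def by (auto simp: insert_commute)
        then show ?thesis using assms(4) by blast
      next
        case False
        then show ?thesis using component_closed[OF zy(2)] \<open>e \<in> E\<close> zy(1) assms(1) by blast
      qed
      then show ?thesis using \<open>e \<in> E\<close> zy unfolding induced_edges_def by blast
    qed
  qed
qed (rule simple)

lemma two_attachments:
  assumes "S \<subseteq> V" "2 \<le> card S" "v \<in> V - S"
  obtains u w where "u \<noteq> w" "u \<in> attachments E S (component E S v)"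
    "w \<in> attachments E S (component E S v)"
proof (rule ccontr)
  let ?K = "component E S v"
  assume "\<not> thesis"
  then have "\<forall>u\<in>attachments E S ?K. \<forall>w\<in>attachments E S ?K. u = w" using that by blast
  moreover have "attachments E S ?K \<subseteq> S" unfolding attachments_def by blast
  moreover have "S \<noteq> {}" using assms(2) by auto
  ultimately obtain s where s: "s \<in> S" "attachments E S ?K \<subseteq> {s}" by blast
  have "?K \<noteq> {}" "?K \<subseteq> V" using component_self assms(3) component_subset by fast+
  moreover from no_cut[OF component_cut[OF assms(3) s(1) assms(1) s(2)]]
  have "insert s ?K = V \<or> V - ?K = V" .
  ultimately have "V = insert s ?K" by blast
  moreover have "?K \<inter> S = {}" using assms(3) by (intro component_disjoint) simp
  ultimately have "S \<subseteq> {s}" using assms(1) by blast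
  then show False using assms(2) card_mono[of "{s}" S] by simp
qed

end

locale uncovered_component = nonseparable +
  fixes S :: "'a set" and v :: 'a
  assumes covered: "S \<subseteq> V" "2 \<le> card S"
    and uncovered: "v \<in> V - S"
begin

abbreviation "K \<equiv> component E S v"

lemma K_subset: "K \<subseteq> V"
  using uncovered component_subset by blast

lemma finite_K: "finite K"
  using uncovered finite_component by blast

lemma K_disjoint: "K \<inter> S = {}"
  using uncovered by (intro component_disjoint) simp

lemma component_subset_K:
  assumes "S \<subseteq> T" "z \<in> K"
  shows "component E T z \<subseteq> K"
  using component_antimono[OF assms(1)] component_eq[OF assms(2)] by blast

lemma ear_exists:
  obtains L where "ear E S K L"
proof -
  obtain u w where uw: "u \<noteq> w" "u \<in> attachments E S K" "w \<in> attachments E S K"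
    using two_attachments[OF covered uncovered] .
  then have "u \<in> S" "w \<in> S" unfolding attachments_def by auto
  then obtain L where "ear E S K L"
    using ear_through_component[of v S E K "[u]" S "[w]"] uw uncovered
    by (auto simp: is_path_def)
  then show ?thesis by (rule that)
qed

lemma ear_interior:
  assumes "ear E S K L"
  obtains a M b where "L = a # M @ [b]" "a \<in> S" "b \<in> S" "M \<noteq> []" "set M \<subseteq> K"
proof -
  have L: "L \<noteq> []" "distinct L" "hd L \<in> S" "last L \<in> S"
      "set L \<subseteq> {hd L, last L} \<union> K" "set L \<inter> K \<noteq> {}"
    using assms unfolding ear_def is_path_def by auto
  have "tl L \<noteq> []"
  proof
    assume "tl L = []"
    then have "set L = {hd L}" using L(1) by (cases L) auto
    then show False using L(3,6) K_disjoint by auto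
  qed
  then obtain a M b where split: "L = a # M @ [b]" by (cases L; cases "tl L" rule: rev_cases) auto
  moreover have "set M \<subseteq> K" using L(2,5) split by auto
  moreover have "M \<noteq> []" using L(3,4,6) K_disjoint split by auto
  ultimately show ?thesis using that L(3,4) by simp
qed

abbreviation leftover :: "'a list \<Rightarrow> 'a \<Rightarrow> 'a set" where
  "leftover L z \<equiv> component E (S \<union> set L) z"

lemma leftover_two_attachments:
  assumes "ear E S K L" "z \<in> K - set L"
  obtains u w where "u \<noteq> w" "u \<in> attachments E (S \<union> set L) (leftover L z)"
    "w \<in> attachments E (S \<union> set L) (leftover L z)"
proof -
  have "S \<union> set L \<subseteq> V" using assms(1) K_subset covered(1) unfolding ear_def by blast
  moreover from this have "card S \<le> card (S \<union> set L)"
    using finite_vertices finite_subset by (blast intro: card_mono)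
  then have "2 \<le> card (S \<union> set L)" using covered(2) by linarith
  moreover have "z \<in> V - (S \<union> set L)" using assms(2) K_disjoint K_subset by blast
  ultimately show ?thesis using that by (rule two_attachments)
qed

lemma ear_reroute:
  assumes L: "ear E S K L" and z: "z \<in> K - set L"
  shows "\<exists>L'. ear E S K L' \<and> set L' \<inter> leftover L z \<noteq> {} \<and>
    attachments E (S \<union> set L) (leftover L z) \<inter> K \<subseteq> set L'"
proof -
  let ?C = "leftover L z"
  let ?N = "attachments E (S \<union> set L) ?C"
  have N: "?N \<subseteq> S \<union> set L" unfolding attachments_def by blast
  have z': "z \<notin> S \<union> set L" using z K_disjoint by blast
  have C: "?C \<subseteq> K" using z by (intro component_subset_K) auto
  obtain u w where uw: "u \<noteq> w" "u \<in> ?N" "w \<in> ?N" using leftover_two_attachments[OF assms] .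
  consider (outside) "?N \<inter> K = {}"
    | (single) y where "y \<in> ?N \<inter> K" "?N \<inter> set L \<subseteq> {y}"
    | (pair) y y' where "y \<in> ?N \<inter> set L" "y' \<in> ?N \<inter> set L" "y \<noteq> y'"
    using N K_disjoint by blast
  then show ?thesis
  proof cases
    case outside
    then have "u \<in> S" "w \<in> S" using uw(2,3) N L unfolding ear_def by auto
    then show ?thesis
      using ear_through_component[OF z' C, of "[u]" S "[w]"] uw outside by (auto simp: is_path_def)
  next
    case single
    then obtain h where h: "h \<in> ?N" "h \<noteq> y" using uw by metis
    then have "h \<in> S - set L" "y \<in> set L - S" using single N K_disjoint by auto
    then have "\<exists>L'. ear E S K L' \<and> set L' \<inter> ?C \<noteq> {} \<and> y \<in> set L'"
      using h(1) single(1) by (intro ear_reroute_end[OF L z' C]) auto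
    moreover have "?N \<inter> K \<subseteq> {y}" using single(2) N K_disjoint by blast
    ultimately show ?thesis by blast
  next
    case pair
    then obtain xs a ys b zs where split: "L = xs @ a # ys @ b # zs"
      and ab: "a \<in> ?N" "b \<in> ?N" "set ys \<inter> ?N = {}"
      using list_split_consecutive[of y L y' ?N] by blast
    then have "?N \<inter> K \<subseteq> set (xs @ [a]) \<union> set (b # zs)" using N K_disjoint by auto
    then show ?thesis using ear_reroute_between[OF L z' C split ab(1,2)] by blast
  qed
qed

text \<open>A rerouted ear keeps all attachments of the component that it enters, so nothing that it
  leaves can reach beyond this component.\<close>

lemma rerouted_ear_component_psubset:
  assumes "ear E S K L" "z \<in> K - set L"
    and L': "set L' \<inter> leftover L z \<noteq> {}"
      "attachments E (S \<union> set L) (leftover L z) \<inter> K \<subseteq> set L'"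
    and y: "y \<in> K - set L'" "leftover L' y \<inter> leftover L z \<noteq> {}"
  shows "leftover L' y \<subset> leftover L z"
proof -
  let ?C = "leftover L z" and ?C' = "leftover L' y"
  obtain x where x: "x \<in> ?C'" "x \<in> ?C" using y(2) by blast
  have "component E (S \<union> set L') x \<subseteq> ?C"
  proof (rule component_least[OF x(2)], rule ccontr)
    fix p q assume pq: "p \<in> ?C" "{p, q} \<in> E" "q \<notin> S \<union> set L'" "q \<notin> ?C"
    have "z \<notin> S \<union> set L" using assms(2) K_disjoint by blast
    from component_closed[OF pq(1,2) this] have "q \<in> S \<union> set L" using pq(4) by blast
    then have "q \<in> attachments E (S \<union> set L) ?C"
      using pq unfolding attachments_def by (auto simp: insert_commute)
    moreover have "q \<in> K" using \<open>q \<in> S \<union> set L\<close> pq(3) assms(1) unfolding ear_def by auto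
    ultimately show False using L'(2) pq(3) by blast
  qed
  then have "?C' \<subseteq> ?C" using component_eq[OF x(1)] by simp
  moreover have "?C' \<inter> (S \<union> set L') = {}" using y(1) K_disjoint by (intro component_disjoint) auto
  ultimately show ?thesis using L'(1) by blast
qed

definition balanced :: "'a list \<Rightarrow> bool" where
  "balanced L \<longleftrightarrow> (\<forall>z\<in>K - set L. 2 * card (leftover L z) \<le> card K)"

lemma balanced_ear_exists: "\<exists>L. ear E S K L \<and> balanced L"
proof (rule ccontr)
  assume unbalanced: "\<nexists>L. ear E S K L \<and> balanced L"
  define heavy where "heavy = (\<lambda>(L, z). ear E S K L \<and> z \<in> K - set L \<and>
    card K < 2 * card (leftover L z))"
  have heavy_exists: "\<exists>z. heavy (L, z)" if "ear E S K L" for L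
    using unbalanced that unfolding heavy_def balanced_def by (auto simp: not_le)
  then obtain p where "heavy p" using ear_exists by metis
  then obtain L z where Lz: "heavy (L, z)"
    and least: "\<And>L' z'. heavy (L', z') \<Longrightarrow> card (leftover L z) \<le> card (leftover L' z')"
    using ex_has_least_nat[of heavy p "\<lambda>(L, z). card (leftover L z)"] by auto
  let ?C = "leftover L z"
  have L: "ear E S K L" "z \<in> K - set L" using Lz unfolding heavy_def by auto
  obtain L' where L': "ear E S K L'" "set L' \<inter> ?C \<noteq> {}"
      "attachments E (S \<union> set L) ?C \<inter> K \<subseteq> set L'"
    using ear_reroute[OF L] by blast
  obtain y where y: "heavy (L', y)" using heavy_exists[OF L'(1)] ..
  let ?C' = "leftover L' y"
  have C: "?C \<subseteq> K" "?C' \<subseteq> K" using L(2) y component_subset_K unfolding heavy_def by auto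
  then have finite: "finite ?C" "finite ?C'" using finite_subset[OF _ finite_K] by auto
  have "?C' \<inter> ?C \<noteq> {}"
  proof
    assume "?C' \<inter> ?C = {}"
    then have "card ?C' + card ?C \<le> card K"
      using card_Un_disjoint[OF finite(2,1)] card_mono[OF finite_K, of "?C' \<union> ?C"] C by simp
    then show False using Lz y unfolding heavy_def by simp
  qed
  then have "?C' \<subset> ?C"
    using y by (intro rerouted_ear_component_psubset[OF L L'(2,3)]) (simp add: heavy_def)
  then have "card ?C' < card ?C" by (rule psubset_card_mono[OF finite(1)])
  then show False using least[OF y] by simp
qed

end


section \<open>A spanning tree of logarithmic block diameter\<close>

context nonseparable
begin

abbreviation tree_on :: "'a set \<Rightarrow> 'a set set \<Rightarrow> bool" where
  "tree_on S \<equiv> tree_basis S (induced_edges E S)"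

abbreviation share_circuit_on :: "'a set \<Rightarrow> 'a set set \<Rightarrow> 'a set \<Rightarrow> 'a set \<Rightarrow> bool" where
  "share_circuit_on S \<equiv> share_circuit S (induced_edges E S)"

definition edge_ball :: "'a set \<Rightarrow> 'a set set \<Rightarrow> 'a set \<Rightarrow> nat \<Rightarrow> 'a set set" where
  "edge_ball S B r d = {f \<in> B. within_steps (share_circuit_on S B) d f r}"

text \<open>Every ear through \<open>K\<close> closes a circuit with some edge at distance at most \<open>d\<close> from \<open>r\<close>.
  Each ear at least halves the component while it raises \<open>d\<close> by one, so \<open>card K * 2 ^ d\<close> does not
  increase.\<close>

definition linked :: "'a set \<Rightarrow> 'a set set \<Rightarrow> 'a set \<Rightarrow> nat \<Rightarrow> 'a set \<Rightarrow> bool" where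
  "linked S B r d K \<longleftrightarrow>
    graph_connected (attachments E S K) (edge_ball S B r d) \<and> card K * 2 ^ d \<le> card V"

definition shallow :: "'a set \<Rightarrow> 'a set set \<Rightarrow> 'a set \<Rightarrow> bool" where
  "shallow S B r \<longleftrightarrow> S \<subseteq> V \<and> r \<in> B \<and> tree_on S B \<and>
    B \<subseteq> edge_ball S B r (floor_log (2 * card V)) \<and>
    (\<forall>v\<in>V - S. \<exists>d. linked S B r d (component E S v))"

lemma edge_ball_mono: "d \<le> d' \<Longrightarrow> edge_ball S B r d \<subseteq> edge_ball S B r d'"
  unfolding edge_ball_def by (auto intro: within_steps_mono)

lemma linked_depth:
  assumes "linked S B r d (component E S v)" "v \<in> V"
  shows "Suc d \<le> floor_log (2 * card V)"
proof -
  have "1 \<le> card (component E S v)"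
    using finite_component[OF assms(2)] component_self[of v E S]
    by (auto simp: Suc_le_eq card_gt_0_iff)
  then have "1 * 2 ^ d \<le> card (component E S v) * 2 ^ d" by (rule mult_right_mono) simp
  then have "2 ^ d \<le> card V" using assms(1) unfolding linked_def by linarith
  then have "2 ^ Suc d \<le> 2 * card V" by simp
  from floor_log_le_iff[OF this] show ?thesis by simp
qed

end

locale ear_extension = uncovered_component +
  fixes B :: "'a set set" and L :: "'a list" and x :: "'a set"
  assumes B: "tree_on S B"
    and L: "ear E S K L" "balanced L"
    and x: "x \<in> path_edges L"
begin

abbreviation "S' \<equiv> S \<union> set L"
abbreviation "B' \<equiv> B \<union> (path_edges L - {x})"

lemma finite_S: "finite S"
  using covered(1) finite_vertices by (rule finite_subset)

lemma ear_path: "distinct L" "hd L \<in> S" "last L \<in> S" "path_edges L \<subseteq> E"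
  using L(1) unfolding ear_def is_path_def by auto

lemma ear_ends_neq: "hd L \<noteq> last L"
proof -
  obtain a M b where "L = a # M @ [b]" using ear_interior[OF L(1)] .
  then show ?thesis using ear_path(1) by auto
qed

lemma ear_ends_attached: "hd L \<in> attachments E S K" "last L \<in> attachments E S K"
proof -
  obtain a M b where M: "L = a # M @ [b]" "a \<in> S" "b \<in> S" "M \<noteq> []" "set M \<subseteq> K"
    using ear_interior[OF L(1)] .
  have "{a, hd M} \<in> E" "{b, last M} \<in> E"
    using ear_path(4) M(1,4) by (auto simp: path_edges_Cons path_edges_append insert_commute)
  moreover have "hd M \<in> K" "last M \<in> K" using M(4,5) by auto
  ultimately show "hd L \<in> attachments E S K" "last L \<in> attachments E S K"
    using M unfolding attachments_def by auto
qed

lemma ear_edge_not_subset: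
  assumes "e \<in> path_edges L"
  shows "\<not> e \<subseteq> S"
proof -
  obtain a M b where M: "L = a # M @ [b]" "M \<noteq> []" "set M \<subseteq> K"
    using ear_interior[OF L(1)] .
  consider "e = {a, hd M}" | "e = {last M, b}" | "e \<in> path_edges M"
    using assms M(1,2) by (auto simp: path_edges_Cons path_edges_append)
  then have "e \<inter> set M \<noteq> {}"
  proof cases
    case 3
    then show ?thesis by (rule path_edges_split) auto
  qed (use M(2) in auto)
  then show ?thesis using M(3) K_disjoint by blast
qed

lemma tree_edge_subset: "e \<in> B \<Longrightarrow> e \<subseteq> S"
  using tree_basisD(1)[OF B] unfolding induced_edges_def by blast

lemma S'_subset: "S' \<subseteq> V"
  using L(1) covered(1) K_subset unfolding ear_def by auto

lemma card_S': "card S' = card S + (length L - 2)"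
proof -
  obtain a M b where M: "L = a # M @ [b]" "a \<in> S" "b \<in> S" "set M \<subseteq> K"
    using ear_interior[OF L(1)] .
  then have "S' = S \<union> set M" "S \<inter> set M = {}" using K_disjoint by auto
  then have "card S' = card S + card (set M)" using finite_S by (simp add: card_Un_disjoint)
  then show ?thesis using ear_path(1) M(1) by (simp add: distinct_card)
qed

lemma tree_on_extension: "tree_on S' B'"
proof (rule tree_basisI)
  show "simple_graph S' (induced_edges E S')" by (rule simple_graph_induced[OF simple S'_subset])
  show "B' \<subseteq> induced_edges E S'"
    using tree_basisD(1)[OF B] ear_path(4) path_edges_subset[of _ L]
    unfolding induced_edges_def by blast
  show "graph_connected S' B'"
    by (rule graph_connected_add_path[OF tree_basisD(2)[OF B] ear_path(1-3) x])
  have "card B' \<le> card B + card (path_edges L - {x})" by (rule card_Un_le)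
  also have "\<dots> \<le> (card S - 1) + (length L - 2)"
    using tree_basisD(3)[OF B] card_path_edges_le[of L] x by simp
  also have "\<dots> = card S' - 1" using card_S' covered(2) by simp
  finally show "card B' \<le> card S' - 1" .
qed

lemma share_circuit_extension: "share_circuit_on S B \<le> share_circuit_on S' B'"
proof (intro predicate2I)
  fix e f assume "share_circuit_on S B e f"
  then obtain y where ef: "e \<in> B" "f \<in> B" and y: "y \<in> induced_edges E S - B"
    and connected: "graph_connected S (insert y (B - {e}))" "graph_connected S (insert y (B - {f}))"
    unfolding share_circuit_def by blast
  have lift: "graph_connected S' (insert y (B' - {g}))"
    if "g \<in> B" "graph_connected S (insert y (B - {g}))" for g
  proof -
    have "insert y (B - {g}) \<union> (path_edges L - {x}) = insert y (B' - {g})"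
      using ear_edge_not_subset tree_edge_subset[OF that(1)] by auto
    then show ?thesis using graph_connected_add_path[OF that(2) ear_path(1-3) x] by simp
  qed
  have "y \<in> induced_edges E S' - B'"
    using y ear_edge_not_subset unfolding induced_edges_def by auto
  then show "share_circuit_on S' B' e f"
    unfolding share_circuit_def by (intro conjI bexI[of _ y] UnI1 ef lift connected)
qed

lemma edge_ball_extension: "edge_ball S B r d \<subseteq> edge_ball S' B' r d"
  unfolding edge_ball_def using within_steps_rel_mono[OF _ share_circuit_extension] by auto

lemma ear_edges_share_circuit:
  assumes "B\<^sub>0 \<subseteq> B" "(hd L, last L) \<in> reach B\<^sub>0"
  obtains f where "f \<in> B\<^sub>0" "\<And>p. p \<in> path_edges L - {x} \<Longrightarrow> share_circuit_on S' B' p f"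
proof -
  obtain f where f: "f \<in> B\<^sub>0"
    and bypass: "\<And>A. B - {f} \<subseteq> A \<Longrightarrow> (hd L, last L) \<in> reach A \<Longrightarrow> graph_connected S A"
    using connected_replaceable_edge[OF tree_basisD(2)[OF B] assms, of "{}"] ear_ends_neq
    by (auto simp: reach_empty)
  have fB: "f \<in> B" "f \<notin> path_edges L"
    using f assms(1) tree_edge_subset ear_edge_not_subset by blast+
  have xE: "x \<in> induced_edges E S' - B'"
    using x ear_path(4) path_edges_subset[OF x] ear_edge_not_subset[OF x] tree_edge_subset
    unfolding induced_edges_def by blast
  have path: "graph_connected (set L) (path_edges L)" by (rule graph_connected_path)
  have ends: "hd L \<in> set L" "last L \<in> set L" using L(1) unfolding ear_def is_path_def by auto
  have "graph_connected S ((B - {f}) \<union> path_edges L)"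
    using reach_mono[OF graph_connectedD[OF path ends]] by (intro bypass) auto
  then have "graph_connected S' ((B - {f}) \<union> path_edges L \<union> path_edges L)"
    using path ends(1) ear_path(2) by (intro graph_connected_Un) auto
  moreover have "(B - {f}) \<union> path_edges L \<union> path_edges L = insert x (B' - {f})"
    using fB(2) x by auto
  ultimately have f_connected: "graph_connected S' (insert x (B' - {f}))" by simp
  have "share_circuit_on S' B' p f" if p: "p \<in> path_edges L - {x}" for p
  proof -
    have "graph_connected S' (B \<union> (path_edges L - {p}))"
      using p by (intro graph_connected_add_path tree_basisD(2)[OF B] ear_path) auto
    moreover have "p \<notin> B" using p ear_edge_not_subset tree_edge_subset by blast
    then have "B \<union> (path_edges L - {p}) = insert x (B' - {p})" using p x by auto
    ultimately have "graph_connected S' (insert x (B' - {p}))" by simp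
    then show ?thesis
      unfolding share_circuit_def using f_connected xE p fB(1) by blast
  qed
  with f show ?thesis by (rule that)
qed

lemma ear_edges_in_ball:
  assumes "linked S B r d K"
  shows "path_edges L - {x} \<subseteq> edge_ball S' B' r (Suc d)"
proof
  have "(hd L, last L) \<in> reach (edge_ball S B r d)"
    using assms ear_ends_attached unfolding linked_def by (blast intro: graph_connectedD)
  then obtain f where f: "f \<in> edge_ball S B r d"
    and circuit: "\<And>p. p \<in> path_edges L - {x} \<Longrightarrow> share_circuit_on S' B' p f"
    by (rule ear_edges_share_circuit[rotated]) (auto simp: edge_ball_def)
  fix p assume p: "p \<in> path_edges L - {x}"
  have "within_steps (share_circuit_on S' B') 1 p f"
    using circuit[OF p] by (rule within_steps_single)
  moreover have "within_steps (share_circuit_on S' B') d f r"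
    using f edge_ball_extension unfolding edge_ball_def by blast
  ultimately have "within_steps (share_circuit_on S' B') (1 + d) p r" by (rule within_steps_trans)
  then show "p \<in> edge_ball S' B' r (Suc d)" using p unfolding edge_ball_def by simp
qed

lemma linked_inside:
  assumes "linked S B r d K" "z \<in> K - set L"
  shows "linked S' B' r (Suc d) (component E S' z)"
proof -
  let ?C = "component E S' z"
  have "?C \<subseteq> K" using assms(2) by (intro component_subset_K) auto
  then have "attachments E S' ?C \<subseteq> attachments E S K \<union> set L" unfolding attachments_def by blast
  moreover have "edge_ball S B r d \<subseteq> edge_ball S' B' r (Suc d)"
    using edge_ball_extension edge_ball_mono[OF le_SucI[OF order_refl]] by (rule subset_trans)
  then have "edge_ball S B r d \<union> (path_edges L - {x}) \<subseteq> edge_ball S' B' r (Suc d)"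
    using ear_edges_in_ball[OF assms(1)] by simp
  moreover have "graph_connected (attachments E S K \<union> set L)
      (edge_ball S B r d \<union> (path_edges L - {x}))"
    using assms(1) x ear_path(1) ear_ends_attached unfolding linked_def
    by (intro graph_connected_add_path) auto
  ultimately have "graph_connected (attachments E S' ?C) (edge_ball S' B' r (Suc d))"
    by (blast intro: graph_connected_mono)
  moreover have "card ?C * 2 ^ Suc d \<le> card V"
  proof -
    have "card ?C * 2 ^ Suc d = 2 * card ?C * 2 ^ d" by simp
    also have "\<dots> \<le> card K * 2 ^ d"
      using L(2) assms(2) unfolding balanced_def by (intro mult_right_mono) auto
    also have "\<dots> \<le> card V" using assms(1) unfolding linked_def by blast
    finally show ?thesis .
  qed
  ultimately show ?thesis unfolding linked_def by blast
qed

lemma attachments_outside: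
  assumes "z \<in> V - S'" "z \<notin> K"
  shows "attachments E S' (component E S' z) \<subseteq> attachments E S (component E S z)"
proof
  have subset: "component E S' z \<subseteq> component E S z" by (rule component_antimono) simp
  fix y assume "y \<in> attachments E S' (component E S' z)"
  then obtain q where y: "y \<in> S'" and q: "q \<in> component E S z" "{y, q} \<in> E"
    using subset unfolding attachments_def by blast
  have "y \<in> S"
  proof (rule ccontr)
    assume "y \<notin> S"
    then have "y \<in> K" using y L(1) unfolding ear_def by auto
    moreover have "q \<notin> S" using q(1) component_disjoint[of z S E] assms(1) by blast
    ultimately have "q \<in> K" using component_closed[OF _ q(2)] uncovered by simp
    then have "component E S z = K" using component_eq[OF q(1)] component_eq[of q E S v] by simp
    then show False using component_self[of z E S] assms(2) by simp
  qed
  then show "y \<in> attachments E S (component E S z)" using q unfolding attachments_def by blast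
qed

lemma linked_outside:
  assumes "linked S B r d (component E S z)" "z \<in> V - S'" "z \<notin> K"
  shows "linked S' B' r d (component E S' z)"
proof -
  have "graph_connected (attachments E S' (component E S' z)) (edge_ball S' B' r d)"
    using assms(1) attachments_outside[OF assms(2,3)] edge_ball_extension
    unfolding linked_def by (blast intro: graph_connected_mono)
  moreover have "card (component E S' z) \<le> card (component E S z)"
    using finite_component assms(2) by (intro card_mono component_antimono) auto
  then have "card (component E S' z) * 2 ^ d \<le> card (component E S z) * 2 ^ d"
    by (rule mult_right_mono) simp
  ultimately show ?thesis using assms(1) unfolding linked_def by linarith
qed

lemma shallow_extension:
  assumes "shallow S B r"
  shows "shallow S' B' r"
proof -
  let ?m = "floor_log (2 * card V)"
  have r: "r \<in> B" and near: "B \<subseteq> edge_ball S B r ?m"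
    and old: "\<And>z. z \<in> V - S \<Longrightarrow> \<exists>d. linked S B r d (component E S z)"
    using assms unfolding shallow_def by auto
  obtain d where d: "linked S B r d K" using old[OF uncovered] ..
  have "Suc d \<le> ?m" using linked_depth[OF d] uncovered by blast
  then have "path_edges L - {x} \<subseteq> edge_ball S' B' r ?m"
    using ear_edges_in_ball[OF d] edge_ball_mono by blast
  then have "B' \<subseteq> edge_ball S' B' r ?m" using near edge_ball_extension by blast
  moreover have "\<exists>d. linked S' B' r d (component E S' z)" if "z \<in> V - S'" for z
    using linked_inside[OF d] linked_outside old that by (cases "z \<in> K") blast+
  ultimately show ?thesis unfolding shallow_def using S'_subset r tree_on_extension by blast
qed

end

context nonseparable
begin

lemma shallow_grow:
  assumes "shallow S B r" "S \<noteq> V"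
  obtains S' B' where "S \<subset> S'" "shallow S' B' r"
proof -
  have S: "S \<subseteq> V" "r \<in> B" "tree_on S B" using assms(1) unfolding shallow_def by auto
  then have "r \<subseteq> S" "card r = 2"
    using simple tree_basisD(1)[OF S(3)] unfolding induced_edges_def simple_graph_def by auto
  then have "2 \<le> card S" using S(1) finite_vertices finite_subset by (metis card_mono)
  obtain v where "v \<in> V - S" using S(1) assms(2) by blast
  interpret uncovered_component V E S v
    by unfold_locales (fact \<open>S \<subseteq> V\<close> \<open>2 \<le> card S\<close> \<open>v \<in> V - S\<close>)+
  obtain L where L: "ear E S K L" "balanced L" using balanced_ear_exists by blast
  obtain a M b where "L = a # M @ [b]" using ear_interior[OF L(1)] .
  then have x: "{a, hd (M @ [b])} \<in> path_edges L" by (simp add: path_edges_Cons)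
  interpret ear_extension V E S v B L "{a, hd (M @ [b])}"
    by unfold_locales (fact \<open>tree_on S B\<close> L x)+
  have "S \<subset> S \<union> set L" using L(1) K_disjoint unfolding ear_def by auto
  then show ?thesis using shallow_extension[OF assms(1)] by (rule that)
qed

lemma shallow_complete: "shallow S B r \<Longrightarrow> \<exists>B'. shallow V B' r"
proof (induction "card (V - S)" arbitrary: S B rule: less_induct)
  case less
  show ?case
  proof (cases "S = V")
    case False
    then obtain S' B' where S': "S \<subset> S'" "shallow S' B' r"
      using shallow_grow[OF less.prems] by metis
    then have "V - S' \<subset> V - S" unfolding shallow_def by blast
    then have "card (V - S') < card (V - S)" using finite_vertices by (intro psubset_card_mono) auto
    then show ?thesis using less.hyps S'(2) by blast
  qed (use less.prems in blast)
qed

lemma shallow_edge: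
  assumes "r \<in> E"
  shows "shallow r {r} r"
proof -
  have r: "r \<subseteq> V" "card r = 2" using assms simple unfolding simple_graph_def by auto
  then obtain a b where "r = {a, b}" by (auto simp: card_2_iff)
  then have connected: "graph_connected r {r}" using graph_connected_edge[of a b] by simp
  have ball: "edge_ball r {r} r d = {r}" for d unfolding edge_ball_def by auto
  have "tree_on r {r}"
    unfolding tree_basis_def using assms connected r(2) by (auto simp: induced_edges_def)
  moreover have "linked r {r} r 0 (component E r v)" if "v \<in> V - r" for v
  proof -
    have "graph_connected (attachments E r (component E r v)) {r}"
      using connected by (rule graph_connected_mono) (auto simp: attachments_def)
    moreover have "card (component E r v) \<le> card V"
      using that component_subset finite_vertices by (intro card_mono) auto
    ultimately show ?thesis unfolding linked_def ball by simp
  qed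
  ultimately show ?thesis unfolding shallow_def ball using r(1) by blast
qed

lemma nonseparable_tree_exists:
  assumes "2 \<le> card V"
  shows "\<exists>B. tree_basis V E B \<and> block_diameter_le V E B (2 * floor_log (2 * card V))"
proof -
  let ?m = "floor_log (2 * card V)"
  have "E \<noteq> {}" using connected_card_edges_ge[OF simple connected] assms by auto
  then obtain r B where "shallow V B r" using shallow_edge shallow_complete by blast
  then have B: "tree_basis V E B" "B \<subseteq> edge_ball V B r ?m"
    unfolding shallow_def induced_edges_vertices[OF simple] by auto
  have near: "within_steps (share_circuit V E B) ?m e r" if "e \<in> B" for e
    using subsetD[OF B(2) that] unfolding edge_ball_def induced_edges_vertices[OF simple] by simp
  have "within_steps (share_circuit V E B) (?m + ?m) e f" if "e \<in> B" "f \<in> B" for e f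
    by (rule within_steps_trans[OF near[OF that(1)] within_share_circuit_sym[OF near[OF that(2)]]])
  then show ?thesis using B(1) unfolding block_diameter_le_def mult_2 by blast
qed

end

theorem log_block_diameter_tree_exists:
  assumes "simple_graph V E" "graph_connected V E"
  shows "\<exists>B. tree_basis V E B \<and> block_diameter_le V E B (2 * floor_log (2 * card V))"
  using assms
proof (induction "card V" arbitrary: V E rule: less_induct)
  case less
  have finite: "finite V" using less.prems(1) unfolding simple_graph_def by simp
  consider (cut) V\<^sub>1 V\<^sub>2 s where "vertex_cut V E V\<^sub>1 V\<^sub>2 s" "V\<^sub>1 \<noteq> V" "V\<^sub>2 \<noteq> V"
    | (small) "card V \<le> 1"
    | (nonseparable) "nonseparable V E" "2 \<le> card V"
    using less.prems unfolding nonseparable_def by force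
  then show ?case
  proof cases
    case cut
    interpret left: vertex_cut V E V\<^sub>1 V\<^sub>2 s by fact
    interpret right: vertex_cut V E V\<^sub>2 V\<^sub>1 s by (rule left.flipped)
    have tree: "\<exists>B. tree_basis W (induced_edges E W) B \<and>
        block_diameter_le W (induced_edges E W) B (2 * floor_log (2 * card V))"
      if "W \<subset> V" "simple_graph W (induced_edges E W)" "graph_connected W (induced_edges E W)" for W
    proof -
      have "card W < card V" using finite \<open>W \<subset> V\<close> by (rule psubset_card_mono)
      moreover from this have "2 * floor_log (2 * card W) \<le> 2 * floor_log (2 * card V)"
        by (intro mult_le_mono2 floor_log_le_iff) simp
      ultimately show ?thesis using less.hyps[of W] that(2,3) block_diameter_le_mono by metis
    qed
    have "V\<^sub>1 \<subset> V" "V\<^sub>2 \<subset> V" using left.vertices(1) cut(2,3) by blast+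
    then show ?thesis
      using tree[OF _ left.simple_side left.induced_connected[OF less.prems(2)]]
        tree[OF _ right.simple_side right.induced_connected[OF less.prems(2)]]
        left.union_tree_basis left.union_block_diameter by blast
  next
    case small
    then have "\<forall>u\<in>V. \<forall>w\<in>V. u = w" using finite by (simp add: card_le_Suc0_iff_eq)
    then have "tree_basis V E {}"
      using small unfolding tree_basis_def graph_connected_iff_reach by auto
    then show ?thesis unfolding block_diameter_le_def by blast
  next
    case nonseparable
    then show ?thesis by (rule nonseparable.nonseparable_tree_exists)
  qed
qed


section \<open>Moving labels\<close>

lemma labelled_spanning_tree_iff:
  assumes "simple_graph V E"
  shows "labelled_spanning_tree V E (B, l) \<longleftrightarrow>
    tree_basis V E B \<and> l \<in> extensional B \<and> bij_betw l B {1..card V - 1}"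
proof
  assume "labelled_spanning_tree V E (B, l)"
  then show "tree_basis V E B \<and> l \<in> extensional B \<and> bij_betw l B {1..card V - 1}"
    unfolding labelled_spanning_tree_def spanning_tree_def tree_basis_def
    by (auto dest: bij_betw_same_card)
qed (auto simp: labelled_spanning_tree_def intro: tree_basis_imp_spanning_tree[OF assms])

lemma exchange_step_iff:
  "exchange_step V E (B, l) (B', l') \<longleftrightarrow>
    (\<exists>e\<in>B. \<exists>x\<in>E - B. B' = insert x (B - {e}) \<and> spanning_tree V E B' \<and>
      l' \<in> extensional B' \<and> l' x = l e \<and> (\<forall>b\<in>B - {e}. l' b = l b))"
proof -
  have "l' = restrict (l(x := l e)) (insert x (B - {e})) \<longleftrightarrow>
      l' \<in> extensional (insert x (B - {e})) \<and> l' x = l e \<and> (\<forall>b\<in>B - {e}. l' b = l b)"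
    if "x \<in> E - B" for e x
    using that by (auto simp: fun_eq_iff extensional_def restrict_def)
  then show ?thesis
    unfolding exchange_step_def case_prod_conv by (intro bex_cong refl) (simp cong: conj_cong)
qed

lemma exchange_stepI:
  assumes "simple_graph V E" "e \<in> B" "x \<in> E - B" "B' = insert x (B - {e})" "tree_basis V E B'"
    and "l' \<in> extensional B'" "l' x = l e" "\<And>b. b \<in> B - {e} \<Longrightarrow> l' b = l b"
  shows "exchange_step V E (B, l) (B', l')"
  using assms tree_basis_imp_spanning_tree[OF assms(1,5)] unfolding exchange_step_iff by blast

definition aligned :: "'a set \<Rightarrow> 'a set set \<Rightarrow> 'a labelled_tree \<Rightarrow> 'a labelled_tree \<Rightarrow> bool" where
  "aligned V E = (\<lambda>(B, l) (B', l'). \<forall>e\<in>B. \<forall>f\<in>B'. l e = l' f \<longrightarrow> exchange_equiv V E e f)"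

lemma aligned_refl: "labelled_spanning_tree V E s \<Longrightarrow> aligned V E s s"
  unfolding labelled_spanning_tree_def aligned_def by (auto dest: bij_betw_imp_inj_on inj_onD)

lemma aligned_sym: "aligned V E s t \<Longrightarrow> aligned V E t s"
  unfolding aligned_def by (auto intro: exchange_equiv_sym)

lemma aligned_trans:
  assumes "labelled_spanning_tree V E s" "labelled_spanning_tree V E t"
    and "aligned V E s t" "aligned V E t u"
  shows "aligned V E s u"
proof -
  obtain B\<^sub>s l\<^sub>s B\<^sub>t l\<^sub>t B\<^sub>u l\<^sub>u where trees: "s = (B\<^sub>s, l\<^sub>s)" "t = (B\<^sub>t, l\<^sub>t)" "u = (B\<^sub>u, l\<^sub>u)"
    by (cases s, cases t, cases u)
  have "exchange_equiv V E e g" if eg: "e \<in> B\<^sub>s" "g \<in> B\<^sub>u" "l\<^sub>s e = l\<^sub>u g" for e g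
  proof -
    have "l\<^sub>s e \<in> l\<^sub>t ` B\<^sub>t"
      using assms(1,2) eg(1) unfolding trees labelled_spanning_tree_def bij_betw_def by auto
    then obtain f where "f \<in> B\<^sub>t" "l\<^sub>s e = l\<^sub>t f" by blast
    then have "exchange_equiv V E e f" "exchange_equiv V E f g"
      using assms(3,4) eg unfolding trees aligned_def by auto
    then show ?thesis by (rule rtranclp_trans)
  qed
  then show ?thesis unfolding trees aligned_def by blast
qed

lemma exchange_step_labelled:
  assumes "labelled_spanning_tree V E (B, l)" "exchange_step V E (B, l) (B', l')"
  shows "labelled_spanning_tree V E (B', l')"
proof -
  obtain e x where e: "e \<in> B" and x: "x \<in> E - B" and B': "B' = insert x (B - {e})"
    and l': "l' x = l e" "\<forall>b\<in>B - {e}. l' b = l b"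
    and tree: "spanning_tree V E B'" "l' \<in> extensional B'"
    using assms(2) unfolding exchange_step_iff by blast
  have "bij_betw (transpose e x) B' B"
    using e x unfolding B'
    by (intro bij_betw_byWitness[where f' = "transpose e x"])
      (auto simp: Transposition.transpose_def)
  moreover have "bij_betw l B {1..card V - 1}"
    using assms(1) unfolding labelled_spanning_tree_def by simp
  ultimately have "bij_betw (l \<circ> transpose e x) B' {1..card V - 1}" by (rule bij_betw_trans)
  moreover have "l' b = (l \<circ> transpose e x) b" if "b \<in> B'" for b
    using that e x l' unfolding B' by (auto simp: Transposition.transpose_def)
  ultimately have "bij_betw l' B' {1..card V - 1}" by (subst bij_betw_cong)
  then show ?thesis using tree unfolding labelled_spanning_tree_def by simp
qed

lemma exchange_step_sym:
  assumes "simple_graph V E" "labelled_spanning_tree V E (B, l)" "exchange_step V E (B, l) (B', l')"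
  shows "exchange_step V E (B', l') (B, l)"
proof -
  have B: "tree_basis V E B" "l \<in> extensional B"
    using assms(2) unfolding labelled_spanning_tree_iff[OF assms(1)] by auto
  obtain e x where e: "e \<in> B" and x: "x \<in> E - B" and B': "B' = insert x (B - {e})"
    and l': "l' x = l e" "\<forall>b\<in>B - {e}. l' b = l b"
    using assms(3) unfolding exchange_step_iff by blast
  show ?thesis
    by (rule exchange_stepI[OF assms(1), where e = x and x = e])
      (use B e x B' l' tree_basisD(1)[OF B(1)] in auto)
qed

lemma exchange_step_aligned:
  assumes "simple_graph V E" "labelled_spanning_tree V E (B, l)" "exchange_step V E (B, l) (B', l')"
  shows "aligned V E (B, l) (B', l')"
proof -
  obtain e x where e: "e \<in> B" and x: "x \<in> E - B" and B': "B' = insert x (B - {e})"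
    and l': "l' x = l e" "\<forall>b\<in>B - {e}. l' b = l b"
    using assms(3) unfolding exchange_step_iff by blast
  have trees: "tree_basis V E B" "tree_basis V E B'" and inj: "inj_on l B"
    using assms(2) exchange_step_labelled[OF assms(2,3)]
    unfolding labelled_spanning_tree_iff[OF assms(1)] by (auto dest: bij_betw_imp_inj_on)
  have "insert e (B - {e}) = B" using e by blast
  then have "exchangeable V E e x"
    unfolding exchangeable_def using trees e x B' by (intro exI[of _ "B - {e}"]) auto
  then show ?thesis
    unfolding aligned_def using e l' inj unfolding B' by (auto dest: inj_onD)
qed

lemma exchange_steps_labelled_aligned:
  assumes "simple_graph V E" "labelled_spanning_tree V E s" "within_steps (exchange_step V E) k s t"
  shows "labelled_spanning_tree V E t \<and> aligned V E s t"
  using within_steps_imp_rtranclp[OF assms(3)]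
proof (induction rule: rtranclp_induct)
  case base
  then show ?case using assms(2) aligned_refl by blast
next
  case (step t u)
  obtain B l B' l' where tu: "t = (B, l)" "u = (B', l')" by (cases t, cases u)
  have "labelled_spanning_tree V E u" "aligned V E t u"
    using exchange_step_labelled exchange_step_aligned[OF assms(1)] step unfolding tu by blast+
  then show ?case using step.IH aligned_trans[OF assms(2)] by blast
qed

lemma exchange_steps_sym:
  assumes "simple_graph V E" "labelled_spanning_tree V E s" "within_steps (exchange_step V E) k s t"
  shows "within_steps (exchange_step V E) k t s"
proof (rule within_steps_reverse[where I = "labelled_spanning_tree V E", OF assms(3,2)])
  fix t u assume step: "labelled_spanning_tree V E t" "exchange_step V E t u"
  obtain B l B' l' where tu: "t = (B, l)" "u = (B', l')" by (cases t, cases u)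
  show "labelled_spanning_tree V E u \<and> exchange_step V E u t"
    using exchange_step_labelled exchange_step_sym[OF assms(1)] step unfolding tu by blast
qed

lemma swap_labels_share_circuit:
  assumes "simple_graph V E" "labelled_spanning_tree V E (B, l)" "share_circuit V E B e f"
  shows "within_steps (exchange_step V E) 3 (B, l) (B, l \<circ> transpose e f)"
proof (cases "e = f")
  case False
  have B: "tree_basis V E B" "l \<in> extensional B"
    using assms(2) unfolding labelled_spanning_tree_iff[OF assms(1)] by auto
  obtain x where ef: "e \<in> B" "f \<in> B" and x: "x \<in> E - B"
    and connected: "graph_connected V (insert x (B - {e}))" "graph_connected V (insert x (B - {f}))"
    using assms(3) unfolding share_circuit_def by blast
  let ?B\<^sub>1 = "insert x (B - {e})" and ?l\<^sub>1 = "l(x := l e, e := undefined)"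
  let ?B\<^sub>2 = "insert x (B - {f})" and ?l\<^sub>2 = "l(x := l e, e := l f, f := undefined)"
  have trees: "tree_basis V E ?B\<^sub>1" "tree_basis V E ?B\<^sub>2"
    using tree_basis_replace_edge[OF assms(1) B(1) _ x] ef connected by auto
  have outside: "l b = undefined" if "b \<notin> B" for b using B(2) that by (simp add: extensional_def)
  note facts = B ef x trees False outside tree_basisD(1)[OF B(1)]
  have "exchange_step V E (B, l) (?B\<^sub>1, ?l\<^sub>1)"
    by (rule exchange_stepI[OF assms(1), of e _ x]) (use facts in \<open>auto simp: extensional_def\<close>)
  moreover have "exchange_step V E (?B\<^sub>1, ?l\<^sub>1) (?B\<^sub>2, ?l\<^sub>2)"
    by (rule exchange_stepI[OF assms(1), of f _ e]) (use facts in \<open>auto simp: extensional_def\<close>)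
  moreover have "exchange_step V E (?B\<^sub>2, ?l\<^sub>2) (B, l \<circ> transpose e f)"
    by (rule exchange_stepI[OF assms(1), of x _ f])
      (use facts in \<open>auto simp: extensional_def Transposition.transpose_def\<close>)
  ultimately have "within_steps (exchange_step V E) (1 + 1 + 1) (B, l) (B, l \<circ> transpose e f)"
    by (blast intro: within_steps_trans within_steps_single)
  then show ?thesis by (simp add: numeral_3_eq_3)
qed simp

text \<open>Along a chain of circuits the transposition \<open>(f e)\<close> is the conjugate of \<open>(g e)\<close> by \<open>(f g)\<close>.\<close>

lemma swap_labels_circuit_chain:
  assumes "simple_graph V E" "labelled_spanning_tree V E (B, l)"
    and "(share_circuit V E B ^^ k) e f"
  shows "within_steps (exchange_step V E) (6 * k) (B, l) (B, l \<circ> transpose e f)"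
  using assms(3,2)
proof (induction k arbitrary: f l)
  case (Suc k)
  note swap = swap_labels_share_circuit[OF assms(1)]
  obtain g where chain: "(share_circuit V E B ^^ k) e g" and gf: "share_circuit V E B g f"
    using Suc.prems(1) by auto
  consider "e = f" | "e = g" | "e \<noteq> f" "e \<noteq> g" by blast
  then show ?case
  proof cases
    case 2
    then have "share_circuit V E B e f" using gf by simp
    then show ?thesis by (intro within_steps_mono[OF swap[OF Suc.prems(2)]]) auto
  next
    case 3
    let ?l\<^sub>1 = "l \<circ> transpose g f"
    let ?l\<^sub>2 = "?l\<^sub>1 \<circ> transpose e g"
    have first: "within_steps (exchange_step V E) 3 (B, l) (B, ?l\<^sub>1)"
      by (rule swap[OF Suc.prems(2) gf])
    then have labelled: "labelled_spanning_tree V E (B, ?l\<^sub>1)"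
      using exchange_steps_labelled_aligned[OF assms(1) Suc.prems(2)] by blast
    have second: "within_steps (exchange_step V E) (6 * k) (B, ?l\<^sub>1) (B, ?l\<^sub>2)"
      by (rule Suc.IH[OF chain labelled])
    then have "labelled_spanning_tree V E (B, ?l\<^sub>2)"
      using exchange_steps_labelled_aligned[OF assms(1) labelled] by blast
    then have third: "within_steps (exchange_step V E) 3 (B, ?l\<^sub>2) (B, ?l\<^sub>2 \<circ> transpose g f)"
      using gf by (rule swap)
    have "?l\<^sub>2 \<circ> transpose g f = l \<circ> (transpose f g \<circ> transpose g e \<circ> transpose f g)"
      by (simp add: comp_assoc transpose_commute)
    also have "\<dots> = l \<circ> transpose e f"
      using 3 transpose_comp_triple[of f e g] by (simp add: transpose_commute)
    finally have "within_steps (exchange_step V E) (3 + 6 * k + 3) (B, l) (B, l \<circ> transpose e f)"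
      using within_steps_trans[OF within_steps_trans[OF first second] third] by (simp only:)
    then show ?thesis by (rule within_steps_mono) simp
  qed simp
qed simp

lemma swap_labels:
  assumes "simple_graph V E" "labelled_spanning_tree V E (B, l)"
    and "within_steps (share_circuit V E B) d e f"
  shows "within_steps (exchange_step V E) (6 * d) (B, l) (B, l \<circ> transpose e f)"
proof -
  obtain k where k: "k \<le> d" "(share_circuit V E B ^^ k) e f"
    using assms(3) unfolding within_steps_def by blast
  show ?thesis
    by (rule within_steps_mono[OF swap_labels_circuit_chain[OF assms(1,2) k(2)]]) (use k(1) in simp)
qed

lemma card_mismatches_transpose_less:
  assumes "finite B" "inj_on l B" "e \<in> B" "f \<in> B" "l e = l' f" "l e \<noteq> l' e"
  shows "card {b \<in> B. (l \<circ> transpose e f) b \<noteq> l' b} < card {b \<in> B. l b \<noteq> l' b}"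
proof (rule psubset_card_mono)
  have "l f \<noteq> l' f" using assms(2-6) by (metis inj_onD)
  then show "{b \<in> B. (l \<circ> transpose e f) b \<noteq> l' b} \<subset> {b \<in> B. l b \<noteq> l' b}"
    using assms(4-6) by (auto simp: Transposition.transpose_def)
qed (use assms(1) in simp)

lemma sort_labels:
  assumes "simple_graph V E" "block_diameter_le V E B d"
    and "labelled_spanning_tree V E (B, l)" "labelled_spanning_tree V E (B, l')"
    and "aligned V E (B, l) (B, l')"
  shows "within_steps (exchange_step V E) (card {b \<in> B. l b \<noteq> l' b} * (6 * d)) (B, l) (B, l')"
  using assms(3,5)
proof (induction "card {b \<in> B. l b \<noteq> l' b}" arbitrary: l rule: less_induct)
  case less
  have l: "l \<in> extensional B" "inj_on l B" and l': "l' \<in> extensional B" and image: "l ` B = l' ` B"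
    using less.prems(1) assms(4) unfolding labelled_spanning_tree_def bij_betw_def by auto
  show ?case
  proof (cases "\<forall>b\<in>B. l b = l' b")
    case True
    then have "l = l'" using l(1) l' by (metis extensionalityI)
    then show ?thesis by simp
  next
    case False
    then obtain e where e: "e \<in> B" "l e \<noteq> l' e" by blast
    then obtain f where f: "f \<in> B" "l e = l' f" using image by blast
    let ?l\<^sub>1 = "l \<circ> transpose e f"
    have "within_steps (share_circuit V E B) d e f"
      using assms(2) less.prems(2) e(1) f unfolding block_diameter_le_def aligned_def by simp
    then have swap: "within_steps (exchange_step V E) (6 * d) (B, l) (B, ?l\<^sub>1)"
      using swap_labels[OF assms(1) less.prems(1)] by blast
    then have labelled: "labelled_spanning_tree V E (B, ?l\<^sub>1)" and "aligned V E (B, l) (B, ?l\<^sub>1)"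
      using exchange_steps_labelled_aligned[OF assms(1) less.prems(1)] by auto
    then have "aligned V E (B, ?l\<^sub>1) (B, l')"
      using aligned_trans aligned_sym less.prems by blast
    moreover have "finite B"
      using less.prems(1) tree_basis_finite[OF assms(1)]
      unfolding labelled_spanning_tree_iff[OF assms(1)] by blast
    then have fewer: "card {b \<in> B. ?l\<^sub>1 b \<noteq> l' b} < card {b \<in> B. l b \<noteq> l' b}"
      using l(2) e(1) f e(2) by (rule card_mismatches_transpose_less)
    ultimately have "within_steps (exchange_step V E)
        (6 * d + card {b \<in> B. ?l\<^sub>1 b \<noteq> l' b} * (6 * d)) (B, l) (B, l')"
      using less.hyps[OF fewer labelled] within_steps_trans[OF swap] by blast
    moreover have "Suc (card {b \<in> B. ?l\<^sub>1 b \<noteq> l' b}) * (6 * d) \<le> card {b \<in> B. l b \<noteq> l' b} * (6 * d)"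
      using fewer by (intro mult_right_mono) auto
    ultimately show ?thesis by (auto elim: within_steps_mono)
  qed
qed

lemma reconfigure_to_tree_basis:
  assumes "simple_graph V E" "tree_basis V E B" "labelled_spanning_tree V E (B\<^sub>1, l\<^sub>1)"
  shows "\<exists>l. within_steps (exchange_step V E) (card (B - B\<^sub>1)) (B\<^sub>1, l\<^sub>1) (B, l)"
  using assms(3)
proof (induction "card (B - B\<^sub>1)" arbitrary: B\<^sub>1 l\<^sub>1)
  case 0
  have B\<^sub>1: "tree_basis V E B\<^sub>1"
    using "0.prems" unfolding labelled_spanning_tree_iff[OF assms(1)] by blast
  have "finite (B - B\<^sub>1)" using tree_basis_finite[OF assms(1,2)] by simp
  then have "B \<subseteq> B\<^sub>1" using "0.hyps" by simp
  moreover have "card B = card B\<^sub>1" using tree_basisD(3)[OF B\<^sub>1] tree_basisD(3)[OF assms(2)] by simp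
  ultimately have "B = B\<^sub>1" using tree_basis_finite[OF assms(1) B\<^sub>1] by (intro card_subset_eq)
  then show ?case by (intro exI[of _ l\<^sub>1]) simp
next
  case (Suc n)
  have B\<^sub>1: "tree_basis V E B\<^sub>1" "l\<^sub>1 \<in> extensional B\<^sub>1"
    using Suc.prems unfolding labelled_spanning_tree_iff[OF assms(1)] by auto
  obtain x where x: "x \<in> B - B\<^sub>1" using Suc.hyps(2) by (metis card.empty ex_in_conv nat.distinct(1))
  obtain e where e: "e \<in> B\<^sub>1 - B" "tree_basis V E (insert x (B\<^sub>1 - {e}))"
    using tree_basis_exchange[OF assms(1) B\<^sub>1(1) assms(2) x] .
  let ?B\<^sub>2 = "insert x (B\<^sub>1 - {e})" and ?l\<^sub>2 = "l\<^sub>1(x := l\<^sub>1 e, e := undefined)"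
  have step: "exchange_step V E (B\<^sub>1, l\<^sub>1) (?B\<^sub>2, ?l\<^sub>2)"
    by (rule exchange_stepI[OF assms(1), of e _ x])
      (use x e B\<^sub>1(2) tree_basisD(1)[OF assms(2)] in \<open>auto simp: extensional_def\<close>)
  have "B - B\<^sub>1 = insert x (B - ?B\<^sub>2)" using x e(1) by auto
  then have "n = card (B - ?B\<^sub>2)" using Suc.hyps(2) tree_basis_finite[OF assms(1,2)] by simp
  then obtain l where rest: "within_steps (exchange_step V E) n (?B\<^sub>2, ?l\<^sub>2) (B, l)"
    using Suc.hyps(1) exchange_step_labelled[OF Suc.prems step] by metis
  have "within_steps (exchange_step V E) 1 (B\<^sub>1, l\<^sub>1) (?B\<^sub>2, ?l\<^sub>2)"
    using step by (rule within_steps_single)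
  from within_steps_trans[OF this rest]
  have "within_steps (exchange_step V E) (1 + n) (B\<^sub>1, l\<^sub>1) (B, l)" .
  then show ?case using Suc.hyps(2) by auto
qed

lemma same_block_imp_aligned:
  assumes "simple_graph V E"
    and "labelled_spanning_tree V E (B\<^sub>1, l\<^sub>1)" "labelled_spanning_tree V E (B\<^sub>2, l\<^sub>2)"
    and "\<forall>i\<in>{1..card V - 1}. same_block E (inv_into B\<^sub>1 l\<^sub>1 i) (inv_into B\<^sub>2 l\<^sub>2 i)"
  shows "aligned V E (B\<^sub>1, l\<^sub>1) (B\<^sub>2, l\<^sub>2)"
proof -
  have bij: "bij_betw l\<^sub>1 B\<^sub>1 {1..card V - 1}" "bij_betw l\<^sub>2 B\<^sub>2 {1..card V - 1}"
    and B\<^sub>1: "tree_basis V E B\<^sub>1"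
    using assms(2,3) unfolding labelled_spanning_tree_iff[OF assms(1)] by auto
  have connected: "graph_connected V E"
    using tree_basisD(1,2)[OF B\<^sub>1] by (blast intro: graph_connected_mono)
  have "exchange_equiv V E e f" if "e \<in> B\<^sub>1" "f \<in> B\<^sub>2" "l\<^sub>1 e = l\<^sub>2 f" for e f
  proof -
    have "l\<^sub>1 e \<in> {1..card V - 1}" using bij(1) that(1) by (rule bij_betwE[rule_format])
    moreover have "inv_into B\<^sub>1 l\<^sub>1 (l\<^sub>1 e) = e" "inv_into B\<^sub>2 l\<^sub>2 (l\<^sub>1 e) = f"
      using bij_betw_inv_into_left[OF bij(1) that(1)] bij_betw_inv_into_left[OF bij(2) that(2)]
        that(3) by simp_all
    ultimately show ?thesis
      using assms(4) same_block_imp_exchange_equiv[OF assms(1) connected] by metis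
  qed
  then show ?thesis unfolding aligned_def by blast
qed

lemma reconfigure:
  assumes "simple_graph V E"
    and "labelled_spanning_tree V E (B\<^sub>1, l\<^sub>1)" "labelled_spanning_tree V E (B\<^sub>2, l\<^sub>2)"
    and "aligned V E (B\<^sub>1, l\<^sub>1) (B\<^sub>2, l\<^sub>2)"
  shows "within_steps (exchange_step V E) (2 * card V + 12 * (card V * floor_log (2 * card V)))
    (B\<^sub>1, l\<^sub>1) (B\<^sub>2, l\<^sub>2)"
proof -
  let ?n = "card V" and ?d = "2 * floor_log (2 * card V)"
  have B\<^sub>1: "tree_basis V E B\<^sub>1"
    using assms(2) unfolding labelled_spanning_tree_iff[OF assms(1)] by blast
  have connected: "graph_connected V E"
    using tree_basisD(1,2)[OF B\<^sub>1] by (blast intro: graph_connected_mono)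
  obtain B where B: "tree_basis V E B" "block_diameter_le V E B ?d"
    using log_block_diameter_tree_exists[OF assms(1) connected] by blast
  obtain l where l: "within_steps (exchange_step V E) (card (B - B\<^sub>1)) (B\<^sub>1, l\<^sub>1) (B, l)"
    using reconfigure_to_tree_basis[OF assms(1) B(1) assms(2)] by blast
  obtain l' where l': "within_steps (exchange_step V E) (card (B - B\<^sub>2)) (B\<^sub>2, l\<^sub>2) (B, l')"
    using reconfigure_to_tree_basis[OF assms(1) B(1) assms(3)] by blast
  note moved = exchange_steps_labelled_aligned[OF assms(1,2) l]
    exchange_steps_labelled_aligned[OF assms(1,3) l']
  then have "aligned V E (B, l) (B, l')"
    using aligned_trans aligned_sym assms(2-4) by blast
  then have sorted: "within_steps (exchange_step V E)
      (card {b \<in> B. l b \<noteq> l' b} * (6 * ?d)) (B, l) (B, l')"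
    using sort_labels[OF assms(1) B(2)] moved by blast
  have finite: "finite B" and "card B \<le> ?n"
    using tree_basis_finite[OF assms(1) B(1)] tree_basisD(3)[OF B(1)] by auto
  then have subset: "card A \<le> ?n" if "A \<subseteq> B" for A using card_mono[OF finite that] by simp
  have "card (B - B\<^sub>1) + card {b \<in> B. l b \<noteq> l' b} * (6 * ?d) + card (B - B\<^sub>2) \<le>
      ?n + ?n * (6 * ?d) + ?n"
    by (intro add_mono mult_right_mono subset) auto
  also have "\<dots> = 2 * ?n + 12 * (?n * floor_log (2 * ?n))" by simp
  finally have "card (B - B\<^sub>1) + card {b \<in> B. l b \<noteq> l' b} * (6 * ?d) + card (B - B\<^sub>2) \<le>
      2 * ?n + 12 * (?n * floor_log (2 * ?n))" .
  with within_steps_trans[OF within_steps_trans[OF l sorted] exchange_steps_sym[OF assms(1,3) l']]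
  show ?thesis by (rule within_steps_mono)
qed

theorem theorem2:
  "\<exists>f :: nat \<Rightarrow> real. f \<in> O(\<lambda>n. real n * ln (real n)) \<and>
     (\<forall>(V :: 'a set) E B\<^sub>1 l\<^sub>1 B\<^sub>2 l\<^sub>2.
        simple_graph V E \<longrightarrow>
        labelled_spanning_tree V E (B\<^sub>1, l\<^sub>1) \<longrightarrow>
        labelled_spanning_tree V E (B\<^sub>2, l\<^sub>2) \<longrightarrow>
        (\<forall>i\<in>{1..card V - 1}. same_block E (inv_into B\<^sub>1 l\<^sub>1 i) (inv_into B\<^sub>2 l\<^sub>2 i)) \<longrightarrow>
        (\<exists>k. real k \<le> f (card V) \<and> (exchange_step V E ^^ k) (B\<^sub>1, l\<^sub>1) (B\<^sub>2, l\<^sub>2)))"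
proof (intro exI[of _ "\<lambda>n. 2 * real n + 12 * (real n * log 2 (2 * real n))"] conjI allI impI)
  show "(\<lambda>n. 2 * real n + 12 * (real n * log 2 (2 * real n))) \<in> O(\<lambda>n. real n * ln (real n))"
    by real_asymp
next
  fix V :: "'a set" and E B\<^sub>1 l\<^sub>1 B\<^sub>2 l\<^sub>2
  let ?n = "card V"
  assume "simple_graph V E"
    and "labelled_spanning_tree V E (B\<^sub>1, l\<^sub>1)" "labelled_spanning_tree V E (B\<^sub>2, l\<^sub>2)"
    and "\<forall>i\<in>{1..?n - 1}. same_block E (inv_into B\<^sub>1 l\<^sub>1 i) (inv_into B\<^sub>2 l\<^sub>2 i)"
  then have "within_steps (exchange_step V E) (2 * ?n + 12 * (?n * floor_log (2 * ?n)))
      (B\<^sub>1, l\<^sub>1) (B\<^sub>2, l\<^sub>2)"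
    by (intro reconfigure same_block_imp_aligned)
  then obtain k where k: "k \<le> 2 * ?n + 12 * (?n * floor_log (2 * ?n))"
    and steps: "(exchange_step V E ^^ k) (B\<^sub>1, l\<^sub>1) (B\<^sub>2, l\<^sub>2)"
    unfolding within_steps_def by blast
  have "real ?n * real (floor_log (2 * ?n)) \<le> real ?n * log 2 (2 * real ?n)"
    by (cases "?n = 0") (auto simp: floor_log_altdef intro!: mult_left_mono)
  moreover have "real k \<le> 2 * real ?n + 12 * (real ?n * real (floor_log (2 * ?n)))"
    using of_nat_mono[OF k, where 'a = real] by simp
  ultimately show "\<exists>k. real k \<le> 2 * real ?n + 12 * (real ?n * log 2 (2 * real ?n)) \<and>
      (exchange_step V E ^^ k) (B\<^sub>1, l\<^sub>1) (B\<^sub>2, l\<^sub>2)"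
    using steps by (intro exI[of _ k]) simp
qed

end
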